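(* Let $V$ and $W$ be absolute matrix order unit spaces and let $\phi,\psi:V\to W$ be completely $|\cdot|$-preserving maps such that $\phi\perp\psi$ (i.e. $\phi$ is completely orthogonal to $\psi$). If $\phi$ and $\psi$ map $\mathcal{OP}_\infty(V)$ into $\mathcal{OP}_\infty(W)$, then: (1) $\phi+\psi$ also maps $\mathcal{OP}_\infty(V)$ into $\mathcal{OP}_\infty(W)$. (2) $\phi$, $\psi$ and $\phi+\psi$ are completely contractive maps with $\|\phi+\psi\|_{cb}=\max\{\|\phi\|_{cb},\|\psi\|_{cb}\}$. (3) If $V$ and $W$ satisfy condition (T), then $K_0(\phi+\psi)=K_0(\phi)+K_0(\psi)$.
   Context: **Absolute matrix order unit spaces.** $M_{m,n}(V)$ denotes $m\times n$ matrices over $V$, $M_{m,n}=M_{m,n}(\mathbb C)$ with operator norm, $v\oplus w$ is the block diagonal matrix, $0_n$ the zero of $M_n(V)$. A matrix ordered space is a complex vector space $V$ with involution (with $[v_{ij}]^*=[v_{ji}^*]$ on matrices) and cones $M_n(V)^+\subset M_n(V)_{sa}$ such that each $(M_n(V)_{sa},M_n(V)^+)$ is a real ordered vector space and $a^*va\in M_m(V)^+$ for $v\in M_n(V)^+$, $a\in M_{n,m}$. It is a matrix order unit space with order unit $e\in V^+$ if $e$ is an order unit for $V_{sa}$, $V^+$ is proper and every $M_n(V)^+$ is Archimedean (if $u\in M_n(V)^+$, $v\in M_n(V)_{sa}$ and $ku+v\in M_n(V)^+$ for all $k>0$, then $v\in M_n(V)^+$). Put $e^n=e\oplus\cdots\oplus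 e\in M_n(V)$ and $\|v\|_n=\inf\left\{k>0:\begin{bmatrix} ke^n & v \\ v^* & ke^n \end{bmatrix}\in M_{2n}(V)^+\right\}$, a norm on $M_n(V)$. An absolutely ordered space $(X,X^+,|\cdot|)$ is a real ordered vector space with $|\cdot|:X\to X^+$ such that: $|v|=v$ for $v\in X^+$; $|v|\pm v\in X^+$; $|kv|=|k||v|$ for $k\in\mathbb R$; if $|u-v|=u+v$ and $0\le w\le v$ then $|u-w|=u+w$; if $|u-v|=u+v$ and $|u-w|=u+w$ then $\big|u-|v\pm w|\big|=u+|v\pm w|$. For $u,v\in X^+$ write $u\perp v$ if $|u-v|=u+v$. An absolute matrix order unit space is a matrix order unit space $(V,\{M_n(V)^+\},e)$ with maps $|\cdot|_{m,n}:M_{m,n}(V)\to M_n(V)^+$ ($|\cdot|_n:=|\cdot|_{n,n}$) such that: (1) each $(M_n(V)_{sa},M_n(V)^+,|\cdot|_n)$ is an absolutely ordered space; (2) $|\alpha v\beta|_{r,s}\le\|\alpha\|\,\big||v|_{m,n}\beta\big|_{n,s}$ for $v\in M_{m,n}(V)$, $\alpha\in M_{r,m}$, $\beta\in M_{n,s}$; (3) $|v\oplus w|_{m+r,n+s}=|v|_{m,n}\oplus|w|_{r,s}$; (4) $\perp=\perp^a_\infty$ on each $M_n(V)^+$, where $u\perp_\infty v$ means $\|k_1u+k_2v\|_n=\max\{\|k_1u\|_n,\|k_2v\|_n\}$ for all $k_1,k_2\in\mathbb R$, and $u\perp^a_\infty v$ means $u_1\perp_\infty v_1$ whenever $0\le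 u_1\le u$, $0\le v_1\le v$. **Projections and equivalence.** $p\in M_n(V)$ is an order projection if $p^*=p$ and $|2p-e^n|_n=e^n$; $\mathcal{OP}_n(V)$ is the set of these, $\mathcal{OP}(V)=\mathcal{OP}_1(V)$, and $\mathcal{OP}_\infty(V)=\bigcup_n\mathcal{OP}_n(V)$. $v\in M_{m,n}(V)$ is a partial isometry ($v\in\mathcal{PI}_{m,n}(V)$) if $|v|_{m,n}$ and $|v^*|_{n,m}$ are order projections. For $p\in\mathcal{OP}_m(V)$, $q\in\mathcal{OP}_n(V)$, $p\sim q$ means there is $v\in\mathcal{PI}_{m,n}(V)$ with $p=|v^*|_{n,m}$ and $q=|v|_{m,n}$. For $p,q\in\mathcal{OP}_\infty(V)$, $p\approx q$ means $p\oplus r\sim q\oplus r$ for some $r\in\mathcal{OP}_\infty(V)$. **Condition (T):** if $u\in\mathcal{PI}_{m,n}(V)$, $v\in\mathcal{PI}_{l,n}(V)$ and $|u|_{m,n}=|v|_{l,n}$, then there is $w\in\mathcal{PI}_{m,l}(V)$ with $|w^*|_{l,m}=|u^*|_{n,m}$ and $|w|_{m,l}=|v^*|_{n,l}$. **$K_0(V)$** (for $V$ satisfying (T)): the abelian group of equivalence classes $[(p,q)]$ of pairs in $\mathcal{OP}_\infty(V)\times\mathcal{OP}_\infty(V)$ under $(p_1,q_1)\equiv(p_2,q_2)\iff p_1\oplus q_2\approx p_2\oplus q_1$, with $[(p_1,q_1)]+[(p_2,q_2)]=[(p_1\oplus p_2,q_1\oplus q_2)]$, identity $[(0,0)]$ and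 $-[(p,q)]=[(q,p)]$. **Maps.** For a linear $\phi:V\to W$, $\phi_n:M_n(V)\to M_n(W)$ is the entrywise amplification; $\phi$ applied to an element of $M_n(V)$ means $\phi_n$. $\|\phi\|_{cb}=\sup_n\|\phi_n\|$ with respect to the norms $\|\cdot\|_n$; completely contractive means $\|\phi\|_{cb}\le1$. A $*$-linear map $\phi$ is completely $|\cdot|$-preserving if $|\phi_n(v)|_n=\phi_n(|v|_n)$ for all $v\in M_n(V)$, $n\in\mathbb N$ (such a map is completely positive). Completely positive maps $\phi,\psi:V\to W$ are completely orthogonal, written $\phi\perp\psi$, if for every $n$ one has $\phi_n(u)\perp\psi_n(v)$ for all $u,v\in M_n(V)^+$; the sum of two completely orthogonal completely $|\cdot|$-preserving maps is completely $|\cdot|$-preserving. For a completely $|\cdot|$-preserving $\phi:V\to W$ with $\phi(e_V)\in\mathcal{OP}(W)$ ($V,W$ satisfying (T)), $K_0(\phi):K_0(V)\to K_0(W)$ is the unique group homomorphism with $K_0(\phi)([(p,0)])=[(\phi(p),0)]$ for all $p\in\mathcal{OP}_\infty(V)$. *)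

theory Defs
  imports
    "Jordan_Normal_Form.Schur_Decomposition"
    "HOL-Analysis.L2_Norm"
    "HOL-Library.Extended_Real"
begin

section \<open>Matrices over a complex vector space\<close>

text \<open>
  \<open>M_{m,n}(V)\<close> is \<open>carrier_mat m n\<close> over the type of \<open>V\<close>.  The index set
  of matrix sizes is \<open>{1, 2, ...}\<close>: the library also has matrices with no rows or no columns,
  and these are excluded explicitly wherever a size is quantified.

  The cones \<open>M_n(V)^+\<close> are the field \<open>mcone\<close>.  All the maps
  \<open>|.|_{m,n}\<close> are collected in one field \<open>mabs\<close>, since a matrix determines
  its own size; only its values on nonempty matrices are used.
\<close>

record 'v matrix_space =
  smul :: "complex \<Rightarrow> 'v \<Rightarrow> 'v"
  star :: "'v \<Rightarrow> 'v"
  mcone :: "nat \<Rightarrow> 'v mat set"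
  ounit :: 'v
  mabs :: "'v mat \<Rightarrow> 'v mat"

definition rsmul :: "('v, 'z) matrix_space_scheme \<Rightarrow> real \<Rightarrow> 'v mat \<Rightarrow> 'v mat" where
  "rsmul V k v = map_mat (smul V (complex_of_real k)) v"

definition mstar :: "('v, 'z) matrix_space_scheme \<Rightarrow> 'v mat \<Rightarrow> 'v mat" where
  "mstar V v = map_mat (star V) (transpose_mat v)"

definition lmult ::
  "('v::ab_group_add, 'z) matrix_space_scheme \<Rightarrow> complex mat \<Rightarrow> 'v mat \<Rightarrow> 'v mat" where
  "lmult V a v = mat (dim_row a) (dim_col v)
     (\<lambda>(i, j). \<Sum>k<dim_row v. smul V (a $$ (i, k)) (v $$ (k, j)))"

definition rmult ::
  "('v::ab_group_add, 'z) matrix_space_scheme \<Rightarrow> 'v mat \<Rightarrow> complex mat \<Rightarrow> 'v mat" where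
  "rmult V v a = mat (dim_row v) (dim_col a)
     (\<lambda>(i, j). \<Sum>k<dim_col v. smul V (a $$ (k, j)) (v $$ (i, k)))"

definition dsum :: "'v::zero mat \<Rightarrow> 'v mat \<Rightarrow> 'v mat" where
  "dsum v w = four_block_mat v (0\<^sub>m (dim_row v) (dim_col w)) (0\<^sub>m (dim_row w) (dim_col v)) w"

definition vec_l2 :: "complex vec \<Rightarrow> real" where
  "vec_l2 x = L2_set (\<lambda>i. cmod (x $ i)) {..<dim_vec x}"

definition mat_opnorm :: "complex mat \<Rightarrow> real" where
  "mat_opnorm a = Sup {vec_l2 (a *\<^sub>v x) | x. x \<in> carrier_vec (dim_col a) \<and> vec_l2 x \<le> 1}"

definition msa :: "('v, 'z) matrix_space_scheme \<Rightarrow> nat \<Rightarrow> 'v mat set" where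
  "msa V n = {v \<in> carrier_mat n n. mstar V v = v}"

definition mle :: "('v::ab_group_add, 'z) matrix_space_scheme \<Rightarrow> nat \<Rightarrow> 'v mat \<Rightarrow> 'v mat \<Rightarrow> bool" where
  "mle V n v w \<longleftrightarrow> w - v \<in> mcone V n"

definition munit :: "('v::zero, 'z) matrix_space_scheme \<Rightarrow> nat \<Rightarrow> 'v mat" where
  "munit V n = mat n n (\<lambda>(i, j). if i = j then ounit V else 0)"


section \<open>Absolute matrix order unit spaces\<close>

definition star_vector_space :: "('v::ab_group_add, 'z) matrix_space_scheme \<Rightarrow> bool" where
  "star_vector_space V \<longleftrightarrow>
     vector_space (smul V) \<and>
     (\<forall>v. star V (star V v) = v) \<and>
     (\<forall>v w. star V (v + w) = star V v + star V w) \<and>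
     (\<forall>c v. star V (smul V c v) = smul V (cnj c) (star V v))"

text \<open>
  Over a \<open>star_vector_space\<close>, \<open>msa V n\<close> is a real vector space under the
  entrywise operations and \<open>rsmul V\<close>, so a real ordered vector space structure
  on it amounts to a cone.
\<close>

definition real_ordered :: "('v::ab_group_add, 'z) matrix_space_scheme \<Rightarrow> nat \<Rightarrow> bool" where
  "real_ordered V n \<longleftrightarrow>
     mcone V n \<subseteq> msa V n \<and>
     0\<^sub>m n n \<in> mcone V n \<and>
     (\<forall>u \<in> mcone V n. \<forall>v \<in> mcone V n. u + v \<in> mcone V n) \<and>
     (\<forall>k \<ge> 0. \<forall>v \<in> mcone V n. rsmul V k v \<in> mcone V n)"

definition matrix_ordered_space :: "('v::ab_group_add, 'z) matrix_space_scheme \<Rightarrow> bool" where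
  "matrix_ordered_space V \<longleftrightarrow>
     star_vector_space V \<and>
     (\<forall>n \<ge> 1. real_ordered V n) \<and>
     (\<forall>m \<ge> 1. \<forall>n \<ge> 1. \<forall>v \<in> mcone V n. \<forall>a \<in> carrier_mat n m.
        rmult V (lmult V (mat_adjoint a) v) a \<in> mcone V m)"

text \<open>\<open>V\<close> itself is identified with \<open>M_1(V)\<close>; in particular \<open>V^+\<close> is \<open>mcone V 1\<close>.\<close>

definition matrix_order_unit_space :: "('v::ab_group_add, 'z) matrix_space_scheme \<Rightarrow> bool" where
  "matrix_order_unit_space V \<longleftrightarrow>
     matrix_ordered_space V \<and>
     munit V 1 \<in> mcone V 1 \<and>
     (\<forall>v \<in> msa V 1. \<exists>k > 0. rsmul V k (munit V 1) + v \<in> mcone V 1 \<and>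
                             rsmul V k (munit V 1) - v \<in> mcone V 1) \<and>
     (\<forall>v. v \<in> mcone V 1 \<and> - v \<in> mcone V 1 \<longrightarrow> v = 0\<^sub>m 1 1) \<and>
     (\<forall>n \<ge> 1. \<forall>u \<in> mcone V n. \<forall>v \<in> msa V n.
        (\<forall>k > 0. rsmul V k u + v \<in> mcone V n) \<longrightarrow> v \<in> mcone V n)"

definition mnorm :: "('v::ab_group_add, 'z) matrix_space_scheme \<Rightarrow> nat \<Rightarrow> 'v mat \<Rightarrow> real" where
  "mnorm V n v = Inf {k. k > 0 \<and>
     four_block_mat (rsmul V k (munit V n)) v (mstar V v) (rsmul V k (munit V n)) \<in> mcone V (2 * n)}"

definition absolutely_ordered :: "('v::ab_group_add, 'z) matrix_space_scheme \<Rightarrow> nat \<Rightarrow> bool" where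
  "absolutely_ordered V n \<longleftrightarrow>
     real_ordered V n \<and>
     (\<forall>v \<in> msa V n. mabs V v \<in> mcone V n) \<and>
     (\<forall>v \<in> mcone V n. mabs V v = v) \<and>
     (\<forall>v \<in> msa V n. mabs V v + v \<in> mcone V n \<and> mabs V v - v \<in> mcone V n) \<and>
     (\<forall>k. \<forall>v \<in> msa V n. mabs V (rsmul V k v) = rsmul V \<bar>k\<bar> (mabs V v)) \<and>
     (\<forall>u \<in> msa V n. \<forall>v \<in> msa V n. \<forall>w \<in> msa V n.
        mabs V (u - v) = u + v \<and> mle V n (0\<^sub>m n n) w \<and> mle V n w v
          \<longrightarrow> mabs V (u - w) = u + w) \<and>
     (\<forall>u \<in> msa V n. \<forall>v \<in> msa V n. \<forall>w \<in> msa V n.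
        mabs V (u - v) = u + v \<and> mabs V (u - w) = u + w
          \<longrightarrow> mabs V (u - mabs V (v + w)) = u + mabs V (v + w) \<and>
              mabs V (u - mabs V (v - w)) = u + mabs V (v - w))"

definition perp :: "('v::ab_group_add, 'z) matrix_space_scheme \<Rightarrow> nat \<Rightarrow> 'v mat \<Rightarrow> 'v mat \<Rightarrow> bool" where
  "perp V n u v \<longleftrightarrow> u \<in> mcone V n \<and> v \<in> mcone V n \<and> mabs V (u - v) = u + v"

definition perp_inf :: "('v::ab_group_add, 'z) matrix_space_scheme \<Rightarrow> nat \<Rightarrow> 'v mat \<Rightarrow> 'v mat \<Rightarrow> bool" where
  "perp_inf V n u v \<longleftrightarrow> u \<in> mcone V n \<and> v \<in> mcone V n \<and>
     (\<forall>k1 k2. mnorm V n (rsmul V k1 u + rsmul V k2 v) =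
              max (mnorm V n (rsmul V k1 u)) (mnorm V n (rsmul V k2 v)))"

definition perp_inf_abs :: "('v::ab_group_add, 'z) matrix_space_scheme \<Rightarrow> nat \<Rightarrow> 'v mat \<Rightarrow> 'v mat \<Rightarrow> bool" where
  "perp_inf_abs V n u v \<longleftrightarrow> u \<in> mcone V n \<and> v \<in> mcone V n \<and>
     (\<forall>u1 \<in> carrier_mat n n. \<forall>v1 \<in> carrier_mat n n.
        mle V n (0\<^sub>m n n) u1 \<and> mle V n u1 u \<and> mle V n (0\<^sub>m n n) v1 \<and> mle V n v1 v
          \<longrightarrow> perp_inf V n u1 v1)"

definition abs_matrix_order_unit_space :: "('v::ab_group_add, 'z) matrix_space_scheme \<Rightarrow> bool" where
  "abs_matrix_order_unit_space V \<longleftrightarrow>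
     matrix_order_unit_space V \<and>
     (\<forall>m \<ge> 1. \<forall>n \<ge> 1. \<forall>v \<in> carrier_mat m n. mabs V v \<in> mcone V n) \<and>
     (\<forall>n \<ge> 1. absolutely_ordered V n) \<and>
     (\<forall>m \<ge> 1. \<forall>n \<ge> 1. \<forall>r \<ge> 1. \<forall>s \<ge> 1.
        \<forall>v \<in> carrier_mat m n. \<forall>\<alpha> \<in> carrier_mat r m. \<forall>\<beta> \<in> carrier_mat n s.
          mle V s (mabs V (rmult V (lmult V \<alpha> v) \<beta>))
                  (rsmul V (mat_opnorm \<alpha>) (mabs V (rmult V (mabs V v) \<beta>)))) \<and>
     (\<forall>m \<ge> 1. \<forall>n \<ge> 1. \<forall>r \<ge> 1. \<forall>s \<ge> 1.
        \<forall>v \<in> carrier_mat m n. \<forall>w \<in> carrier_mat r s.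
          mabs V (dsum v w) = dsum (mabs V v) (mabs V w)) \<and>
     (\<forall>n \<ge> 1. \<forall>u \<in> mcone V n. \<forall>v \<in> mcone V n. perp V n u v \<longleftrightarrow> perp_inf_abs V n u v)"


section \<open>Projections, partial isometries and the Grothendieck group\<close>

definition OP :: "('v::ab_group_add, 'z) matrix_space_scheme \<Rightarrow> nat \<Rightarrow> 'v mat set" where
  "OP V n = {p \<in> carrier_mat n n. mstar V p = p \<and> mabs V (rsmul V 2 p - munit V n) = munit V n}"

definition OP_inf :: "('v::ab_group_add, 'z) matrix_space_scheme \<Rightarrow> 'v mat set" where
  "OP_inf V = (\<Union>n \<in> {1..}. OP V n)"

definition PI :: "('v::ab_group_add, 'z) matrix_space_scheme \<Rightarrow> nat \<Rightarrow> nat \<Rightarrow> 'v mat set" where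
  "PI V m n = {v \<in> carrier_mat m n. mabs V v \<in> OP V n \<and> mabs V (mstar V v) \<in> OP V m}"

definition proj_sim :: "('v::ab_group_add, 'z) matrix_space_scheme \<Rightarrow> 'v mat \<Rightarrow> 'v mat \<Rightarrow> bool" where
  "proj_sim V p q \<longleftrightarrow>
     (\<exists>m \<ge> 1. \<exists>n \<ge> 1. p \<in> OP V m \<and> q \<in> OP V n \<and>
        (\<exists>v \<in> PI V m n. p = mabs V (mstar V v) \<and> q = mabs V v))"

definition proj_approx :: "('v::ab_group_add, 'z) matrix_space_scheme \<Rightarrow> 'v mat \<Rightarrow> 'v mat \<Rightarrow> bool" where
  "proj_approx V p q \<longleftrightarrow>
     p \<in> OP_inf V \<and> q \<in> OP_inf V \<and> (\<exists>r \<in> OP_inf V. proj_sim V (dsum p r) (dsum q r))"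

definition condition_T :: "('v::ab_group_add, 'z) matrix_space_scheme \<Rightarrow> bool" where
  "condition_T V \<longleftrightarrow>
     (\<forall>m \<ge> 1. \<forall>n \<ge> 1. \<forall>l \<ge> 1. \<forall>u \<in> PI V m n. \<forall>v \<in> PI V l n. mabs V u = mabs V v
        \<longrightarrow> (\<exists>w \<in> PI V m l. mabs V (mstar V w) = mabs V (mstar V u) \<and>
                             mabs V w = mabs V (mstar V v)))"

definition K0_rel ::
  "('v::ab_group_add, 'z) matrix_space_scheme \<Rightarrow> (('v mat \<times> 'v mat) \<times> ('v mat \<times> 'v mat)) set" where
  "K0_rel V = {((p1, q1), (p2, q2)).
     p1 \<in> OP_inf V \<and> q1 \<in> OP_inf V \<and> p2 \<in> OP_inf V \<and> q2 \<in> OP_inf V \<and>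
     proj_approx V (dsum p1 q2) (dsum p2 q1)}"

definition K0_class ::
  "('v::ab_group_add, 'z) matrix_space_scheme \<Rightarrow> 'v mat \<Rightarrow> 'v mat \<Rightarrow> ('v mat \<times> 'v mat) set" where
  "K0_class V p q = K0_rel V `` {(p, q)}"

text \<open>
  The operation on classes is the usual lifting to a quotient by a union over representatives,
  as in \<open>HOL.Equiv_Relations\<close>.  The zero in the class of \<open>(0, 0)\<close> and in
  \<open>[(p, 0)]\<close> below is taken to be the zero of \<open>M_1(V)\<close>.
\<close>

definition K0 :: "('v::ab_group_add, 'z) matrix_space_scheme \<Rightarrow> ('v mat \<times> 'v mat) set monoid" where
  "K0 V = \<lparr>carrier = (OP_inf V \<times> OP_inf V) // K0_rel V,
           monoid.mult = (\<lambda>A B. \<Union>(p1, q1) \<in> A. \<Union>(p2, q2) \<in> B. K0_class V (dsum p1 p2) (dsum q1 q2)),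
           monoid.one = K0_class V (0\<^sub>m 1 1) (0\<^sub>m 1 1)\<rparr>"


section \<open>Maps\<close>

definition star_linear ::
  "('v::ab_group_add, 'y) matrix_space_scheme \<Rightarrow> ('w::ab_group_add, 'z) matrix_space_scheme \<Rightarrow>
   ('v \<Rightarrow> 'w) \<Rightarrow> bool" where
  "star_linear V W \<phi> \<longleftrightarrow>
     Vector_Spaces.linear (smul V) (smul W) \<phi> \<and> (\<forall>v. \<phi> (star V v) = star W (\<phi> v))"

text \<open>The amplification of \<open>\<phi>\<close> is \<open>map_mat \<phi>\<close>.\<close>

definition completely_abs_preserving ::
  "('v::ab_group_add, 'y) matrix_space_scheme \<Rightarrow> ('w::ab_group_add, 'z) matrix_space_scheme \<Rightarrow>
   ('v \<Rightarrow> 'w) \<Rightarrow> bool" where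
  "completely_abs_preserving V W \<phi> \<longleftrightarrow> star_linear V W \<phi> \<and>
     (\<forall>n \<ge> 1. \<forall>v \<in> carrier_mat n n. mabs W (map_mat \<phi> v) = map_mat \<phi> (mabs V v))"

definition completely_positive ::
  "('v::ab_group_add, 'y) matrix_space_scheme \<Rightarrow> ('w::ab_group_add, 'z) matrix_space_scheme \<Rightarrow>
   ('v \<Rightarrow> 'w) \<Rightarrow> bool" where
  "completely_positive V W \<phi> \<longleftrightarrow> Vector_Spaces.linear (smul V) (smul W) \<phi> \<and>
     (\<forall>n \<ge> 1. \<forall>v \<in> mcone V n. map_mat \<phi> v \<in> mcone W n)"

definition completely_orthogonal ::
  "('v::ab_group_add, 'y) matrix_space_scheme \<Rightarrow> ('w::ab_group_add, 'z) matrix_space_scheme \<Rightarrow>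
   ('v \<Rightarrow> 'w) \<Rightarrow> ('v \<Rightarrow> 'w) \<Rightarrow> bool" where
  "completely_orthogonal V W \<phi> \<psi> \<longleftrightarrow>
     completely_positive V W \<phi> \<and> completely_positive V W \<psi> \<and>
     (\<forall>n \<ge> 1. \<forall>u \<in> mcone V n. \<forall>v \<in> mcone V n. perp W n (map_mat \<phi> u) (map_mat \<psi> v))"

text \<open>
  The completely bounded norm may be infinite, hence the values in \<open>ereal\<close>.
\<close>

definition amp_norm ::
  "('v::ab_group_add, 'y) matrix_space_scheme \<Rightarrow> ('w::ab_group_add, 'z) matrix_space_scheme \<Rightarrow>
   ('v \<Rightarrow> 'w) \<Rightarrow> nat \<Rightarrow> ereal" where
  "amp_norm V W \<phi> n =
     (SUP v \<in> {v \<in> carrier_mat n n. mnorm V n v \<le> 1}. ereal (mnorm W n (map_mat \<phi> v)))"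

definition cb_norm ::
  "('v::ab_group_add, 'y) matrix_space_scheme \<Rightarrow> ('w::ab_group_add, 'z) matrix_space_scheme \<Rightarrow>
   ('v \<Rightarrow> 'w) \<Rightarrow> ereal" where
  "cb_norm V W \<phi> = (SUP n \<in> {1..}. amp_norm V W \<phi> n)"

definition completely_contractive ::
  "('v::ab_group_add, 'y) matrix_space_scheme \<Rightarrow> ('w::ab_group_add, 'z) matrix_space_scheme \<Rightarrow>
   ('v \<Rightarrow> 'w) \<Rightarrow> bool" where
  "completely_contractive V W \<phi> \<longleftrightarrow> cb_norm V W \<phi> \<le> 1"

definition maps_projections ::
  "('v::ab_group_add, 'y) matrix_space_scheme \<Rightarrow> ('w::ab_group_add, 'z) matrix_space_scheme \<Rightarrow>
   ('v \<Rightarrow> 'w) \<Rightarrow> bool" where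
  "maps_projections V W \<phi> \<longleftrightarrow> (\<forall>p \<in> OP_inf V. map_mat \<phi> p \<in> OP_inf W)"

text \<open>
  \<open>extensional\<close> pins down the values outside \<open>carrier (K0 V)\<close>; without it a
  homomorphism would not be unique as a function on the whole type.
\<close>

definition K0_map ::
  "('v::ab_group_add, 'y) matrix_space_scheme \<Rightarrow> ('w::ab_group_add, 'z) matrix_space_scheme \<Rightarrow>
   ('v \<Rightarrow> 'w) \<Rightarrow> ('v mat \<times> 'v mat) set \<Rightarrow> ('w mat \<times> 'w mat) set" where
  "K0_map V W \<phi> =
     (THE f. f \<in> hom (K0 V) (K0 W) \<and> f \<in> extensional (carrier (K0 V)) \<and>
        (\<forall>p \<in> OP_inf V. f (K0_class V p (0\<^sub>m 1 1)) = K0_class W (map_mat \<phi> p) (0\<^sub>m 1 1)))"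

end

theory Submission
  imports Defs
begin

text \<open>
  Everything rests on the fact that \<open>|u + v| = |u| + |v|\<close> as soon as \<open>|u| \<perpendicular> |v|\<close> and
  \<open>|u*| \<perpendicular> |v*|\<close>.  For self-adjoint elements this follows from the axioms on \<open>\<perpendicular>\<close> by splitting
  both into positive and negative parts; a general \<open>v\<close> is replaced by the self-adjoint
  \<open>[[0, v], [v*, 0]]\<close>, whose absolute value is \<open>|v*| \<oplus> |v|\<close> because permuting rows does not change
  absolute values.  Hence \<open>\<phi> + \<psi>\<close> preserves absolute values.  If \<open>p \<perpendicular> q\<close> are projections, the norm
  characterisation of \<open>\<perpendicular>\<close> gives \<open>p + q \<le> e\<close>, so that \<open>p + q\<close> is a projection, and
  \<open>[[p, q], [0, 0]]\<close> is a partial isometry between \<open>(p + q) \<oplus> 0\<close> and \<open>p \<oplus> q\<close>.  Applied to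
  \<open>\<phi>(p)\<close> and \<open>\<psi>(p)\<close> this gives (1) and (3).  For (2), a map of the given kind sends \<open>e\<close> to a
  projection, so its completely bounded norm is at most \<open>1\<close>, and it is \<open>1\<close> unless that
  projection, and then the map, is zero, since nonzero projections have norm \<open>1\<close>.
\<close>

section \<open>Entrywise calculus of block sums and row selections\<close>

lemma mat_minus_zero:
  fixes A :: "'a::group_add mat"
  shows "A \<in> carrier_mat m n \<Longrightarrow> A - 0\<^sub>m m n = A"
  by (rule eq_matI) auto

lemma mstar_simps [simp]:
  "dim_row (mstar V v) = dim_col v" "dim_col (mstar V v) = dim_row v"
  "i < dim_col v \<Longrightarrow> j < dim_row v \<Longrightarrow> mstar V v $$ (i, j) = star V (v $$ (j, i))"
  by (simp_all add: mstar_def)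

lemma rsmul_simps [simp]:
  "dim_row (rsmul V k v) = dim_row v" "dim_col (rsmul V k v) = dim_col v"
  "i < dim_row v \<Longrightarrow> j < dim_col v \<Longrightarrow> rsmul V k v $$ (i, j) = smul V (complex_of_real k) (v $$ (i, j))"
  by (simp_all add: rsmul_def)

lemma munit_simps [simp]:
  "dim_row (munit V n) = n" "dim_col (munit V n) = n"
  "i < n \<Longrightarrow> j < n \<Longrightarrow> munit V n $$ (i, j) = (if i = j then ounit V else 0)"
  by (simp_all add: munit_def)

lemma dsum_simps [simp]:
  "dim_row (dsum v w) = dim_row v + dim_row w" "dim_col (dsum v w) = dim_col v + dim_col w"
  "i < dim_row v + dim_row w \<Longrightarrow> j < dim_col v + dim_col w \<Longrightarrow> dsum v w $$ (i, j) =
     (if i < dim_row v then if j < dim_col v then v $$ (i, j) else 0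
      else if j < dim_col v then 0 else w $$ (i - dim_row v, j - dim_col v))"
  by (auto simp: dsum_def)

lemma carrier_simps [simp]:
  "v \<in> carrier_mat m n \<Longrightarrow> mstar V v \<in> carrier_mat n m"
  "v \<in> carrier_mat m n \<Longrightarrow> rsmul V k v \<in> carrier_mat m n"
  "munit V n \<in> carrier_mat n n"
  "v \<in> carrier_mat m n \<Longrightarrow> w \<in> carrier_mat r s \<Longrightarrow> dsum v w \<in> carrier_mat (m + r) (n + s)"
  by auto

lemma dsum_assoc: "dsum (dsum u v) w = dsum u (dsum v w)"
  unfolding dsum_def by (rule assoc_four_block_mat[symmetric])

lemma dsum_eq_iff:
  assumes "v \<in> carrier_mat m n" "v' \<in> carrier_mat m n" "w \<in> carrier_mat r s" "w' \<in> carrier_mat r s"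
  shows "dsum v w = dsum v' w' \<longleftrightarrow> v = v' \<and> w = w'"
proof
  assume eq: "dsum v w = dsum v' w'"
  show "v = v' \<and> w = w'"
  proof (intro conjI eq_matI)
    fix i j assume "i < dim_row v'" "j < dim_col v'"
    then show "v $$ (i, j) = v' $$ (i, j)"
      using arg_cong[OF eq, of "\<lambda>x. x $$ (i, j)"] assms by auto
  next
    fix i j assume "i < dim_row w'" "j < dim_col w'"
    then show "w $$ (i, j) = w' $$ (i, j)"
      using arg_cong[OF eq, of "\<lambda>x. x $$ (m + i, n + j)"] assms by auto
  qed (use assms in auto)
qed simp

lemma dsum_add:
  assumes "v \<in> carrier_mat m n" "v' \<in> carrier_mat m n" "w \<in> carrier_mat r s" "w' \<in> carrier_mat r s"
  shows "dsum v w + dsum v' w' = dsum (v + v') (w + (w' :: 'a::monoid_add mat))"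
  using assms by (intro eq_matI) auto

lemma dsum_diff:
  assumes "v \<in> carrier_mat m n" "v' \<in> carrier_mat m n" "w \<in> carrier_mat r s" "w' \<in> carrier_mat r s"
  shows "dsum v w - dsum v' w' = dsum (v - v') (w - (w' :: 'a::group_add mat))"
  using assms by (intro eq_matI) auto

lemma dsum_munit: "dsum (munit V m) (munit V n) = munit V (m + n)"
  by (rule eq_matI) auto

text \<open>The columns of \<open>w\<close> come first, so \<open>adsum v (mstar V v)\<close> is the
  self-adjoint dilation \<open>[[0, v], [v*, 0]]\<close>. It is also the off-diagonal part of the
  block matrix in \<open>mnorm\<close>.\<close>

definition adsum :: "'v::zero mat \<Rightarrow> 'v mat \<Rightarrow> 'v mat" where
  "adsum v w = four_block_mat (0\<^sub>m (dim_row v) (dim_col w)) v w (0\<^sub>m (dim_row w) (dim_col v))"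

lemma adsum_simps [simp]:
  "dim_row (adsum v w) = dim_row v + dim_row w" "dim_col (adsum v w) = dim_col w + dim_col v"
  "i < dim_row v + dim_row w \<Longrightarrow> j < dim_col w + dim_col v \<Longrightarrow> adsum v w $$ (i, j) =
     (if i < dim_row v then if j < dim_col w then 0 else v $$ (i, j - dim_col w)
      else if j < dim_col w then w $$ (i - dim_row v, j) else 0)"
  by (auto simp: adsum_def)

lemma adsum_carrier [simp]:
  "v \<in> carrier_mat m n \<Longrightarrow> w \<in> carrier_mat r s \<Longrightarrow> adsum v w \<in> carrier_mat (m + r) (s + n)"
  by auto

lemma adsum_add:
  assumes "v \<in> carrier_mat m n" "v' \<in> carrier_mat m n" "w \<in> carrier_mat r s" "w' \<in> carrier_mat r s"
  shows "adsum v w + adsum v' w' = adsum (v + v') (w + (w' :: 'a::monoid_add mat))"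
  using assms by (intro eq_matI) auto

text \<open>An index \<open>f i\<close> beyond the last row produces a zero row, so this one
  operation covers permutations of rows as well as a change in the number of zero rows.\<close>

definition row_select :: "nat \<Rightarrow> (nat \<Rightarrow> nat) \<Rightarrow> 'v::zero mat \<Rightarrow> 'v mat" where
  "row_select r f v = mat r (dim_col v) (\<lambda>(i, j). if f i < dim_row v then v $$ (f i, j) else 0)"

lemma row_select_simps [simp]:
  "dim_row (row_select r f v) = r" "dim_col (row_select r f v) = dim_col v"
  "i < r \<Longrightarrow> j < dim_col v \<Longrightarrow>
     row_select r f v $$ (i, j) = (if f i < dim_row v then v $$ (f i, j) else 0)"
  by (simp_all add: row_select_def)

lemma row_select_inverse:
  assumes "\<And>i. i < dim_row v \<Longrightarrow> g i < r \<and> f (g i) = i"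
  shows "row_select (dim_row v) g (row_select r f v) = v"
  using assms by (intro eq_matI) auto

definition select_mat :: "nat \<Rightarrow> nat \<Rightarrow> (nat \<Rightarrow> nat) \<Rightarrow> complex mat" where
  "select_mat r m f = mat r m (\<lambda>(i, k). if k = f i then 1 else 0)"

lemma select_mat_simps [simp]:
  "dim_row (select_mat r m f) = r" "dim_col (select_mat r m f) = m"
  "i < r \<Longrightarrow> k < m \<Longrightarrow> select_mat r m f $$ (i, k) = (if k = f i then 1 else 0)"
  by (simp_all add: select_mat_def)

text \<open>Each coordinate of \<open>x\<close> occurs at most once among the coordinates of the
  image, so the l2 norm cannot grow. Injectivity concerns only indices that hit an actual row; all
  others contribute zero.\<close>

lemma mat_opnorm_select_mat_le:
  assumes inj: "inj_on f {i. i < r \<and> f i < m}"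
  shows "mat_opnorm (select_mat r m f) \<le> 1"
  unfolding mat_opnorm_def
proof (rule cSup_least)
  show "{vec_l2 (select_mat r m f *\<^sub>v x) |x.
      x \<in> carrier_vec (dim_col (select_mat r m f)) \<and> vec_l2 x \<le> 1} \<noteq> {}"
    by (auto intro!: exI[of _ "0\<^sub>v m"] simp: vec_l2_def L2_set_def)
next
  fix y assume "y \<in> {vec_l2 (select_mat r m f *\<^sub>v x) |x.
      x \<in> carrier_vec (dim_col (select_mat r m f)) \<and> vec_l2 x \<le> 1}"
  then obtain x where x: "x \<in> carrier_vec m" "vec_l2 x \<le> 1"
    and y: "y = vec_l2 (select_mat r m f *\<^sub>v x)" by auto
  let ?S = "{i. i < r \<and> f i < m}"
  have entry: "(select_mat r m f *\<^sub>v x) $ i = (if f i < m then x $ f i else 0)" if "i < r" for i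
  proof -
    have "(select_mat r m f *\<^sub>v x) $ i = (\<Sum>k<m. (if k = f i then 1 else 0) * x $ k)"
      using that x by (auto simp: scalar_prod_def atLeast0LessThan intro!: sum.cong)
    also have "\<dots> = (\<Sum>k<m. if k = f i then x $ k else 0)"
      by (rule sum.cong) auto
    finally show ?thesis by (simp add: sum.delta)
  qed
  have "(\<Sum>i<r. (cmod ((select_mat r m f *\<^sub>v x) $ i))\<^sup>2) = (\<Sum>i\<in>?S. (cmod (x $ f i))\<^sup>2)"
    by (rule sum.mono_neutral_cong_right) (auto simp: entry simp del: index_mult_mat_vec split: if_splits)
  also have "\<dots> = (\<Sum>k\<in>f ` ?S. (cmod (x $ k))\<^sup>2)"
    by (simp add: sum.reindex[OF inj])
  also have "\<dots> \<le> (\<Sum>k<m. (cmod (x $ k))\<^sup>2)"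
    by (rule sum_mono2) auto
  finally have "vec_l2 (select_mat r m f *\<^sub>v x) \<le> vec_l2 x"
    using x by (auto simp: vec_l2_def L2_set_def)
  then show "y \<le> 1" using x y by simp
qed

section \<open>Involution and real scalars on matrices over one space\<close>

locale abs_matrix_order_unit =
  fixes V :: "('v::ab_group_add, 'z) matrix_space_scheme"
  assumes V: "abs_matrix_order_unit_space V"
begin

lemma matrix_order_unit: "matrix_order_unit_space V"
  using V unfolding abs_matrix_order_unit_space_def by (rule conjunct1)

lemma ordered: "matrix_ordered_space V"
  using matrix_order_unit unfolding matrix_order_unit_space_def by (rule conjunct1)

lemma svs: "star_vector_space V"
  using ordered unfolding matrix_ordered_space_def by (rule conjunct1)

lemma abs_ordered: "n \<ge> 1 \<Longrightarrow> absolutely_ordered V n"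
  using V unfolding abs_matrix_order_unit_space_def by (elim conjE) blast

sublocale vs: vector_space "smul V"
  using svs by (simp add: star_vector_space_def)

lemma star_star [simp]: "star V (star V x) = x"
  and star_add [simp]: "star V (x + y) = star V x + star V y"
  and star_smul [simp]: "star V (smul V c x) = smul V (cnj c) (star V x)"
  using svs by (auto simp: star_vector_space_def)

lemma star_0 [simp]: "star V 0 = 0"
  using star_add[of 0 0] by (simp del: star_add)

lemma star_minus [simp]: "star V (- x) = - star V x"
  using star_add[of x "- x"] by (simp add: eq_neg_iff_add_eq_0 add.commute del: star_add)

lemma star_diff [simp]: "star V (x - y) = star V x - star V y"
  using star_add[of x "- y"] by (simp del: star_add)

lemma mstar_mstar [simp]: "mstar V (mstar V v) = v"
  by (rule eq_matI) auto

lemma mstar_dsum: "mstar V (dsum v w) = dsum (mstar V v) (mstar V w)"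
  by (rule eq_matI) auto

lemma mstar_adsum: "mstar V (adsum v w) = adsum (mstar V w) (mstar V v)"
  by (rule eq_matI) auto

lemma mstar_add:
  "v \<in> carrier_mat m n \<Longrightarrow> w \<in> carrier_mat m n \<Longrightarrow> mstar V (v + w) = mstar V v + mstar V w"
  by (rule eq_matI) auto

lemma mstar_diff:
  "v \<in> carrier_mat m n \<Longrightarrow> w \<in> carrier_mat m n \<Longrightarrow> mstar V (v - w) = mstar V v - mstar V w"
  by (rule eq_matI) auto

lemma mstar_zero [simp]: "mstar V (0\<^sub>m m n) = 0\<^sub>m n m"
  by (rule eq_matI) auto

lemma mstar_rsmul: "mstar V (rsmul V k v) = rsmul V k (mstar V v)"
  by (rule eq_matI) auto

lemma rsmul_1 [simp]: "rsmul V 1 v = v"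
  by (rule eq_matI) auto

lemma rsmul_0: "v \<in> carrier_mat m n \<Longrightarrow> rsmul V 0 v = 0\<^sub>m m n"
  by (rule eq_matI) auto

lemma rsmul_minus_1: "rsmul V (- 1) v = - v"
  by (rule eq_matI) auto

lemma rsmul_rsmul: "rsmul V k (rsmul V l v) = rsmul V (k * l) v"
  by (rule eq_matI) auto

lemma rsmul_left_distrib: "rsmul V (k + l) v = rsmul V k v + rsmul V l v"
  by (rule eq_matI) (auto simp: vs.scale_left_distrib)

lemma rsmul_left_diff: "rsmul V (k - l) v = rsmul V k v - rsmul V l v"
  by (rule eq_matI) (auto simp: vs.scale_left_diff_distrib)

lemma rsmul_2: "rsmul V 2 v = v + v"
  using rsmul_left_distrib[of 1 1 v] by simp

lemma rsmul_cancel: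
  assumes "k \<noteq> 0" "rsmul V k v = rsmul V k w"
  shows "v = w"
proof -
  have "v = rsmul V (1 / k) (rsmul V k v)" using assms(1) by (simp add: rsmul_rsmul)
  also have "\<dots> = rsmul V (1 / k) (rsmul V k w)" by (simp only: assms(2))
  also have "\<dots> = w" using assms(1) by (simp add: rsmul_rsmul)
  finally show ?thesis .
qed

lemma sum_smul_delta:
  fixes n :: nat
  shows
  "(\<Sum>k<n. smul V (if k = x then c else 0) (g k)) = (if x < n then smul V c (g x) else 0)"
proof -
  have "(\<Sum>k<n. smul V (if k = x then c else 0) (g k)) = (\<Sum>k<n. if k = x then smul V c (g k) else 0)"
    by (rule sum.cong) auto
  then show ?thesis by (simp add: sum.delta)
qed

section \<open>The cones\<close>

context
  fixes n :: nat
  assumes n: "n \<ge> 1"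
begin

lemma real_ord: "real_ordered V n"
  using n ordered by (simp add: matrix_ordered_space_def)

lemma cone_msa: "v \<in> mcone V n \<Longrightarrow> v \<in> msa V n"
  and cone_zero [simp]: "0\<^sub>m n n \<in> mcone V n"
  and cone_add: "v \<in> mcone V n \<Longrightarrow> w \<in> mcone V n \<Longrightarrow> v + w \<in> mcone V n"
  and cone_rsmul: "k \<ge> 0 \<Longrightarrow> v \<in> mcone V n \<Longrightarrow> rsmul V k v \<in> mcone V n"
  using real_ord by (auto simp: real_ordered_def)

lemma cone_carrier: "v \<in> mcone V n \<Longrightarrow> v \<in> carrier_mat n n"
  and cone_star: "v \<in> mcone V n \<Longrightarrow> mstar V v = v"
  using cone_msa by (auto simp: msa_def)

text \<open>This is \<open>a* v a\<close> written out entrywise, with \<open>a\<close> a function of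
  two indices, so that the sums collapse for sparse \<open>a\<close>.\<close>

lemma cone_conj:
  assumes "v \<in> mcone V n" "m \<ge> 1"
  shows "mat m m (\<lambda>(i, j). \<Sum>l<n. smul V (a l j) (\<Sum>k<n. smul V (cnj (a k i)) (v $$ (k, l)))) \<in> mcone V m"
proof -
  let ?a = "mat n m (\<lambda>(k, i). a k i)"
  have v: "v \<in> carrier_mat n n" using assms cone_carrier by simp
  have adj: "mat_adjoint ?a $$ (i, k) = cnj (a k i)" if "i < m" "k < n" for i k
    using that by (simp add: mat_adjoint_def mat_of_rows_def)
  have dim: "dim_row (mat_adjoint ?a) = m" "dim_col (mat_adjoint ?a) = n"
    by (auto simp: mat_adjoint_def)
  have "?a \<in> carrier_mat n m" by simp
  then have "rmult V (lmult V (mat_adjoint ?a) v) ?a \<in> mcone V m"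
    using ordered assms n unfolding matrix_ordered_space_def by blast
  also have "rmult V (lmult V (mat_adjoint ?a) v) ?a =
    mat m m (\<lambda>(i, j). \<Sum>l<n. smul V (a l j) (\<Sum>k<n. smul V (cnj (a k i)) (v $$ (k, l))))"
    using v by (intro eq_matI) (auto simp: rmult_def lmult_def dim adj intro!: sum.cong arg_cong[where f="smul V _"])
  finally show ?thesis .
qed

text \<open>Compression by the matrix whose column \<open>i\<close> is \<open>s i\<close> times the
  unit vector at \<open>f i\<close>. This single form yields diagonal corners, repeated blocks and
  conjugation by diagonal signs.\<close>

lemma cone_select:
  assumes "v \<in> mcone V n" "m \<ge> 1"
  shows "mat m m (\<lambda>(i, j). if f i < n \<and> f j < n
      then smul V (complex_of_real (s i * s j)) (v $$ (f i, f j)) else 0) \<in> mcone V m" (is "?M \<in> _")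
proof -
  let ?a = "\<lambda>k i. if k = f i then complex_of_real (s i) else 0"
  have "?M = mat m m (\<lambda>(i, j). \<Sum>l<n. smul V (?a l j) (\<Sum>k<n. smul V (cnj (?a k i)) (v $$ (k, l))))"
    by (rule eq_matI) (auto simp: sum_smul_delta if_distrib[of cnj] mult.commute cong: if_cong)
  then show ?thesis using cone_conj[OF assms, of ?a] by simp
qed

text \<open>Compression of a two-by-two block matrix by the column block
  \<open>[1; -1]\<close>.\<close>

lemma cone_block_diff:
  assumes "v \<in> mcone V (n + n)"
  shows "mat n n (\<lambda>(i, j). v $$ (i, j) - v $$ (i, n + j) - v $$ (n + i, j) + v $$ (n + i, n + j)) \<in> mcone V n"
    (is "?M \<in> _")
proof -
  let ?a = "\<lambda>k i. if k = i then 1 else if k = n + i then - 1 else (0 :: complex)"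
  have *: "(\<Sum>k<n+n. smul V (?a k i) (g k)) = g i - g (n + i)" if "i < n" for i g
  proof -
    have "(\<Sum>k<n+n. smul V (?a k i) (g k)) =
      (\<Sum>k<n+n. (if k = i then g k else 0) + (if k = n + i then - g k else 0))"
      using n by (intro sum.cong) auto
    also have "\<dots> = g i - g (n + i)"
      using that by (simp add: sum.distrib sum.delta)
    finally show ?thesis .
  qed
  have **: "cnj (?a k i) = ?a k i" for k i by simp
  have "mat n n (\<lambda>(i, j). \<Sum>l<n+n. smul V (?a l j) (\<Sum>k<n+n. smul V (cnj (?a k i)) (v $$ (k, l)))) \<in> mcone V n"
    using abs_matrix_order_unit.cone_conj[OF abs_matrix_order_unit_axioms, of "n + n" v n ?a] assms n by simp
  also have "mat n n (\<lambda>(i, j). \<Sum>l<n+n. smul V (?a l j) (\<Sum>k<n+n. smul V (cnj (?a k i)) (v $$ (k, l)))) = ?M"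
    unfolding ** by (rule eq_matI) (simp_all add: *)
  finally show ?thesis .
qed

lemma archimedean:
  assumes "u \<in> mcone V n" "v \<in> msa V n" "\<And>k. k > 0 \<Longrightarrow> rsmul V k u + v \<in> mcone V n"
  shows "v \<in> mcone V n"
  using matrix_order_unit n assms unfolding matrix_order_unit_space_def by blast

lemma mabs_of_cone [simp]: "v \<in> mcone V n \<Longrightarrow> mabs V v = v"
  and mabs_add_cone: "v \<in> msa V n \<Longrightarrow> mabs V v + v \<in> mcone V n"
  and mabs_diff_cone: "v \<in> msa V n \<Longrightarrow> mabs V v - v \<in> mcone V n"
  and mabs_rsmul: "v \<in> msa V n \<Longrightarrow> mabs V (rsmul V k v) = rsmul V \<bar>k\<bar> (mabs V v)"
  using abs_ordered[OF n] by (auto simp: absolutely_ordered_def)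

text \<open>Properness is an axiom for size 1 only. In every size the absolute value supplies it: if
  \<open>u\<close> and \<open>-u\<close> are positive, then \<open>-u = |-u| = |u| = u\<close>, so
  \<open>2u = 0\<close>.\<close>

lemma cone_antisym_zero:
  assumes "u \<in> mcone V n" "- u \<in> mcone V n"
  shows "u = 0\<^sub>m n n"
proof -
  have "- u = mabs V (rsmul V (- 1) u)" using assms by (simp add: rsmul_minus_1)
  also have "\<dots> = u" using assms cone_msa by (simp add: mabs_rsmul del: mabs_of_cone) simp
  finally have "u = - u" by simp
  then have "rsmul V 2 u = rsmul V 0 u"
    using cone_carrier[OF assms(1)] rsmul_left_distrib[of 1 "- 1" u] by (simp add: rsmul_2 rsmul_minus_1)
  then have "rsmul V 2 u = 0\<^sub>m n n"
    using cone_carrier[OF assms(1)] by (simp add: rsmul_0)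
  then have "rsmul V 2 u = rsmul V 2 (0\<^sub>m n n)" by (auto simp: rsmul_2)
  then show ?thesis by (rule rsmul_cancel[rotated]) simp
qed

lemma cone_antisym:
  assumes "u - v \<in> mcone V n" "v - u \<in> mcone V n"
    and "u \<in> carrier_mat n n" "v \<in> carrier_mat n n"
  shows "u = v"
proof -
  have "- (u - v) = v - u" using assms by (intro eq_matI) auto
  then have z: "u - v = 0\<^sub>m n n" using cone_antisym_zero assms by simp
  show ?thesis
  proof (rule eq_matI)
    fix i j assume "i < dim_row v" "j < dim_col v"
    then show "u $$ (i, j) = v $$ (i, j)"
      using arg_cong[OF z, of "\<lambda>x. x $$ (i, j)"] assms by auto
  qed (use assms in auto)
qed

end

lemma mabs_cone: "m \<ge> 1 \<Longrightarrow> n \<ge> 1 \<Longrightarrow> v \<in> carrier_mat m n \<Longrightarrow> mabs V v \<in> mcone V n"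
  using V by (auto simp: abs_matrix_order_unit_space_def)

lemma mabs_carrier: "m \<ge> 1 \<Longrightarrow> n \<ge> 1 \<Longrightarrow> v \<in> carrier_mat m n \<Longrightarrow> mabs V v \<in> carrier_mat n n"
  using mabs_cone cone_carrier by blast

lemma mabs_dsum:
  "m \<ge> 1 \<Longrightarrow> n \<ge> 1 \<Longrightarrow> r \<ge> 1 \<Longrightarrow> s \<ge> 1 \<Longrightarrow> v \<in> carrier_mat m n \<Longrightarrow> w \<in> carrier_mat r s \<Longrightarrow>
     mabs V (dsum v w) = dsum (mabs V v) (mabs V w)"
  using V unfolding abs_matrix_order_unit_space_def by blast

text \<open>Positive elements equal their absolute values, and
  \<open>|v| \<oplus> |w| = |v \<oplus> w|\<close> is positive.\<close>

lemma cone_dsum: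
  assumes "m \<ge> 1" "n \<ge> 1" "v \<in> mcone V m" "w \<in> mcone V n"
  shows "dsum v w \<in> mcone V (m + n)"
proof -
  note [simp] = cone_carrier[OF assms(1,3)] cone_carrier[OF assms(2,4)]
  have "dsum v w = dsum (mabs V v) (mabs V w)" using assms by simp
  also have "\<dots> = mabs V (dsum v w)" using mabs_dsum[of m m n n v w] assms by simp
  also have "\<dots> \<in> mcone V (m + n)" using assms by (intro mabs_cone[where m = "m + n"]) auto
  finally show ?thesis .
qed

section \<open>Invariance of the absolute value under row selection\<close>

lemma lmult_select_mat:
  "lmult V (select_mat r (dim_row v) f) v = row_select r f v"
  by (rule eq_matI) (simp_all add: lmult_def sum_smul_delta cong: sum.cong_simp)

lemma rmult_one: "v \<in> carrier_mat m n \<Longrightarrow> rmult V v (1\<^sub>m n) = v"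
  by (rule eq_matI) (auto simp: rmult_def sum_smul_delta cong: sum.cong_simp)

lemma mabs_mult_le:
  assumes "m \<ge> 1" "n \<ge> 1" "r \<ge> 1" "s \<ge> 1"
    and "v \<in> carrier_mat m n" "\<alpha> \<in> carrier_mat r m" "\<beta> \<in> carrier_mat n s"
  shows "mle V s (mabs V (rmult V (lmult V \<alpha> v) \<beta>))
           (rsmul V (mat_opnorm \<alpha>) (mabs V (rmult V (mabs V v) \<beta>)))"
proof -
  have "\<forall>m \<ge> 1. \<forall>n \<ge> 1. \<forall>r \<ge> 1. \<forall>s \<ge> 1.
        \<forall>v \<in> carrier_mat m n. \<forall>\<alpha> \<in> carrier_mat r m. \<forall>\<beta> \<in> carrier_mat n s.
          mle V s (mabs V (rmult V (lmult V \<alpha> v) \<beta>))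
                  (rsmul V (mat_opnorm \<alpha>) (mabs V (rmult V (mabs V v) \<beta>)))"
    using V unfolding abs_matrix_order_unit_space_def by (elim conjE)
  from this[rule_format, OF assms] show ?thesis .
qed

text \<open>Axiom (2) with a selection matrix on the left and the identity on the right. As the
  operator norm \<open>?k\<close> of the selection matrix is at most 1, the positive term
  \<open>(1 - ?k)|v|\<close> closes the gap between \<open>?k |v|\<close> and
  \<open>|v|\<close>.\<close>

lemma mabs_row_select_le:
  assumes "m \<ge> 1" "n \<ge> 1" "r \<ge> 1" "v \<in> carrier_mat m n" "inj_on f {i. i < r \<and> f i < m}"
  shows "mabs V v - mabs V (row_select r f v) \<in> mcone V n"
proof -
  let ?k = "mat_opnorm (select_mat r m f)"
  have sc: "row_select r f v \<in> carrier_mat r n" using assms by auto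
  have sel: "select_mat r m f \<in> carrier_mat r m" by auto
  have "mle V n (mabs V (rmult V (lmult V (select_mat r m f) v) (1\<^sub>m n)))
         (rsmul V ?k (mabs V (rmult V (mabs V v) (1\<^sub>m n))))"
    by (rule mabs_mult_le[OF assms(1-3,2,4) sel one_carrier_mat])
  also have "lmult V (select_mat r m f) v = row_select r f v"
    using lmult_select_mat[of r v f] assms by auto
  finally have 1: "rsmul V ?k (mabs V v) - mabs V (row_select r f v) \<in> mcone V n"
    using rmult_one[OF mabs_carrier[OF assms(1,2,4)]] rmult_one[OF sc]
      mabs_of_cone[OF assms(2) mabs_cone[OF assms(1,2,4)]] by (simp add: mle_def)
  have 2: "rsmul V (1 - ?k) (mabs V v) \<in> mcone V n"
    using mat_opnorm_select_mat_le[OF assms(5)] assms by (intro cone_rsmul mabs_cone) auto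
  have "mabs V v - mabs V (row_select r f v) = rsmul V (1 - ?k) (mabs V v) +
    (rsmul V ?k (mabs V v) - mabs V (row_select r f v))"
    using mabs_carrier[OF assms(1,2,4)] mabs_carrier[OF assms(3,2) sc]
    unfolding rsmul_left_diff by (intro eq_matI) auto
  then show ?thesis using cone_add[OF assms(2) 2 1] by simp
qed

text \<open>If every row of \<open>v\<close> survives, then \<open>v\<close> is in turn a row
  selection of the selected matrix. The inequality holds in both directions and antisymmetry of the
  order gives equality.\<close>

lemma mabs_row_select:
  assumes "m \<ge> 1" "n \<ge> 1" "r \<ge> 1" "v \<in> carrier_mat m n" "inj_on f {i. i < r \<and> f i < m}"
    and g: "\<And>i. i < m \<Longrightarrow> g i < r \<and> f (g i) = i" "inj_on g {i. i < m \<and> g i < r}"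
  shows "mabs V (row_select r f v) = mabs V v"
proof (rule cone_antisym[OF assms(2)])
  have sc: "row_select r f v \<in> carrier_mat r n" using assms by auto
  have "row_select m g (row_select r f v) = v"
    using row_select_inverse[of v g r f] assms by auto
  then show "mabs V (row_select r f v) - mabs V v \<in> mcone V n"
    using mabs_row_select_le[OF assms(3,2,1) sc g(2)] by simp
  show "mabs V v - mabs V (row_select r f v) \<in> mcone V n"
    by (rule mabs_row_select_le[OF assms(1-5)])
  show "mabs V (row_select r f v) \<in> carrier_mat n n" "mabs V v \<in> carrier_mat n n"
    using mabs_carrier assms sc by blast+
qed

text \<open>Exchanging the two row blocks turns \<open>[[0, v], [w, 0]]\<close> into
  \<open>w \<oplus> v\<close>; \<open>?f\<close> and \<open>?g\<close> are this block exchange and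
  its inverse.\<close>

lemma mabs_adsum:
  assumes "a \<ge> 1" "b \<ge> 1" "c \<ge> 1" "d \<ge> 1" "v \<in> carrier_mat a b" "w \<in> carrier_mat c d"
  shows "mabs V (adsum v w) = dsum (mabs V w) (mabs V v)"
proof -
  let ?f = "\<lambda>i. if i < a then i + c else i - a"
  let ?g = "\<lambda>i. if i < c then i + a else i - c"
  have "adsum v w = row_select (a + c) ?f (dsum w v)"
    using assms by (intro eq_matI) auto
  also have "mabs V \<dots> = mabs V (dsum w v)"
    using assms by (intro mabs_row_select[where m = "c + a" and n = "d + b" and g = ?g])
      (auto simp: inj_on_def split: if_splits)
  finally show ?thesis using mabs_dsum[of c d a b w v] assms by simp
qed

text \<open>The shift by \<open>n\<close> selects no existing row, so the rectangular zero is a row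
  selection of the square zero, whose absolute value is known from positivity.\<close>

lemma mabs_zero:
  assumes "m \<ge> 1" "n \<ge> 1"
  shows "mabs V (0\<^sub>m m n) = 0\<^sub>m n n"
proof (rule cone_antisym[OF assms(2)])
  have eq: "0\<^sub>m m n = row_select m (\<lambda>i. i + n) (0\<^sub>m n n)"
    by (rule eq_matI) auto
  have "mabs V (0\<^sub>m n n) - mabs V (row_select m (\<lambda>i. i + n) (0\<^sub>m n n)) \<in> mcone V n"
    using assms by (intro mabs_row_select_le[of n]) auto
  then show "0\<^sub>m n n - mabs V (0\<^sub>m m n) \<in> mcone V n"
    by (simp only: eq mabs_of_cone[OF assms(2) cone_zero[OF assms(2)]])
  have "mabs V (0\<^sub>m m n) \<in> mcone V n" using assms by (intro mabs_cone[of m]) auto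
  then show "mabs V (0\<^sub>m m n) - 0\<^sub>m n n \<in> mcone V n"
    using cone_carrier[OF assms(2)] by (simp add: mat_minus_zero)
  show "mabs V (0\<^sub>m m n) \<in> carrier_mat n n" using assms by (intro mabs_carrier) auto
qed simp

lemma msa_carrier: "v \<in> msa V n \<Longrightarrow> v \<in> carrier_mat n n"
  by (simp add: msa_def)

lemma msa_add: "v \<in> msa V n \<Longrightarrow> w \<in> msa V n \<Longrightarrow> v + w \<in> msa V n"
  by (auto simp: msa_def mstar_add[of _ n n])

lemma msa_diff: "v \<in> msa V n \<Longrightarrow> w \<in> msa V n \<Longrightarrow> v - w \<in> msa V n"
  by (auto simp: msa_def mstar_diff[of _ n n])

lemma msa_rsmul: "v \<in> msa V n \<Longrightarrow> rsmul V k v \<in> msa V n"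
  by (auto simp: msa_def mstar_rsmul)

lemma adsum_star_msa:
  assumes "v \<in> carrier_mat m n"
  shows "adsum v (mstar V v) \<in> msa V (m + n)"
  using assms by (simp add: msa_def mstar_adsum)

section \<open>Orthogonality\<close>

lemma perp_cone:
  assumes "perp V n u v"
  shows "u \<in> mcone V n" "v \<in> mcone V n" "mabs V (u - v) = u + v"
  using assms by (auto simp: perp_def)

context
  fixes n :: nat
  assumes n: "n \<ge> 1"
begin

lemma perp_sym:
  assumes "perp V n u v"
  shows "perp V n v u"
proof -
  note c = perp_cone[OF assms]
  note car = cone_carrier[OF n c(1)] cone_carrier[OF n c(2)]
  have "v - u = rsmul V (- 1) (u - v)"
    using car by (intro eq_matI) auto
  then have "mabs V (v - u) = u + v"
    using c by (simp add: mabs_rsmul[OF n] msa_diff cone_msa[OF n])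
  then show ?thesis using c car by (simp add: perp_def comm_add_mat)
qed

lemma perp_mono_right:
  assumes "perp V n u v" "w \<in> mcone V n" "v - w \<in> mcone V n"
  shows "perp V n u w"
proof -
  note c = perp_cone[OF assms(1)]
  have "\<forall>u \<in> msa V n. \<forall>v \<in> msa V n. \<forall>w \<in> msa V n.
        mabs V (u - v) = u + v \<and> mle V n (0\<^sub>m n n) w \<and> mle V n w v
          \<longrightarrow> mabs V (u - w) = u + w"
    using abs_ordered[OF n] unfolding absolutely_ordered_def by (elim conjE)
  moreover have "u \<in> msa V n" "v \<in> msa V n" "w \<in> msa V n"
    using c assms cone_msa[OF n] by auto
  moreover have "mle V n (0\<^sub>m n n) w" "mle V n w v"
    using assms mat_minus_zero[OF cone_carrier[OF n assms(2)]] by (simp_all add: mle_def)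
  ultimately have "mabs V (u - w) = u + w" using c(3) by blast
  then show ?thesis using c assms by (simp add: perp_def)
qed

lemma perp_mono:
  assumes "perp V n u v" "u' \<in> mcone V n" "u - u' \<in> mcone V n" "v' \<in> mcone V n" "v - v' \<in> mcone V n"
  shows "perp V n u' v'"
  using assms perp_mono_right perp_sym by blast

text \<open>The axiom speaks of \<open>|v + w|\<close>, which is \<open>v + w\<close> because both
  summands are positive.\<close>

lemma perp_add_right:
  assumes "perp V n u v" "perp V n u w"
  shows "perp V n u (v + w)"
proof -
  note c = perp_cone[OF assms(1)] perp_cone[OF assms(2)]
  have "\<forall>u \<in> msa V n. \<forall>v \<in> msa V n. \<forall>w \<in> msa V n.
        mabs V (u - v) = u + v \<and> mabs V (u - w) = u + w
          \<longrightarrow> mabs V (u - mabs V (v + w)) = u + mabs V (v + w) \<and>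
              mabs V (u - mabs V (v - w)) = u + mabs V (v - w)"
    using abs_ordered[OF n] unfolding absolutely_ordered_def by (elim conjE)
  then have "mabs V (u - mabs V (v + w)) = u + mabs V (v + w)"
    using c cone_msa[OF n] by blast
  then show ?thesis using c by (simp add: perp_def mabs_of_cone[OF n] cone_add[OF n])
qed

lemma perp_add:
  assumes "perp V n u v" "perp V n u w" "perp V n u' v" "perp V n u' w"
  shows "perp V n (u + u') (v + w)"
  using assms by (meson perp_add_right perp_sym)

text \<open>The parts \<open>|a| + a\<close> and \<open>|a| - a\<close> are twice the positive and negative part of \<open>a\<close>;
  all four parts of \<open>a\<close> and \<open>b\<close> that have to be orthogonal are dominated by \<open>2|a|\<close> or \<open>2|b|\<close>.\<close>

lemma mabs_add_of_perp_msa: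
  assumes a: "a \<in> msa V n" and b: "b \<in> msa V n" and perp: "perp V n (mabs V a) (mabs V b)"
  shows "mabs V (a + b) = mabs V a + mabs V b"
proof -
  \<comment> \<open>The two parts have difference \<open>2x\<close> and sum \<open>2|x|\<close>, so
    their orthogonality amounts to \<open>|2x| = 2|x|\<close>.\<close>
  have parts: "perp V n (mabs V x + x) (mabs V x - x)" if "x \<in> msa V n" for x
  proof -
    have car: "x \<in> carrier_mat n n" "mabs V x \<in> carrier_mat n n"
      using msa_carrier[OF that] mabs_carrier[OF n n] by auto
    have "(mabs V x + x) - (mabs V x - x) = rsmul V 2 x"
      unfolding rsmul_2 using car by (intro eq_matI) auto
    moreover have "(mabs V x + x) + (mabs V x - x) = rsmul V 2 (mabs V x)"
      unfolding rsmul_2 using car by (intro eq_matI) auto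
    ultimately show ?thesis
      using mabs_add_cone[OF n that] mabs_diff_cone[OF n that] mabs_rsmul[OF n that, of 2]
      by (simp add: perp_def)
  qed
  let ?A = "mabs V a" and ?B = "mabs V b"
  have car: "a \<in> carrier_mat n n" "b \<in> carrier_mat n n" "?A \<in> carrier_mat n n" "?B \<in> carrier_mat n n"
    using msa_carrier a b mabs_carrier[OF n n] by auto
  note cones = mabs_add_cone[OF n a] mabs_diff_cone[OF n a] mabs_add_cone[OF n b] mabs_diff_cone[OF n b]
  have AB: "perp V n (?A + ?A) (?B + ?B)" using perp by (simp add: perp_add)
  have split: "?A + ?A - (?A + a) = ?A - a" "?A + ?A - (?A - a) = ?A + a"
    "?B + ?B - (?B + b) = ?B - b" "?B + ?B - (?B - b) = ?B + b"
    using car by (auto intro!: eq_matI)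
  have "perp V n (?A + a) (?B - b)" "perp V n (?A - a) (?B + b)"
    using cones by (auto intro!: perp_mono[OF AB] simp: split)
  \<comment> \<open>Both positive parts are now orthogonal to both negative parts. The difference of
    the two sums is \<open>2(a + b)\<close> and their total is \<open>2(|a| + |b|)\<close>.\<close>
  then have "perp V n ((?A + a) + (?B + b)) ((?A - a) + (?B - b))"
    using parts[OF a] parts[OF b] by (intro perp_add) (auto intro: perp_sym)
  then have "mabs V (((?A + a) + (?B + b)) - ((?A - a) + (?B - b)))
      = ((?A + a) + (?B + b)) + ((?A - a) + (?B - b))"
    by (simp add: perp_def)
  moreover have "((?A + a) + (?B + b)) - ((?A - a) + (?B - b)) = rsmul V 2 (a + b)"
    unfolding rsmul_2 using car by (intro eq_matI) (auto simp: algebra_simps)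
  moreover have "((?A + a) + (?B + b)) + ((?A - a) + (?B - b)) = rsmul V 2 (?A + ?B)"
    unfolding rsmul_2 using car by (intro eq_matI) (auto simp: algebra_simps)
  ultimately have "rsmul V 2 (mabs V (a + b)) = rsmul V 2 (?A + ?B)"
    using mabs_rsmul[OF n msa_add[OF a b], of 2] by simp
  then show ?thesis by (rule rsmul_cancel[rotated]) simp
qed

end

lemma perp_dsum:
  assumes "m \<ge> 1" "n \<ge> 1" "perp V m a c" "perp V n b d"
  shows "perp V (m + n) (dsum a b) (dsum c d)"
proof -
  note p = perp_cone[OF assms(3)] perp_cone[OF assms(4)]
  have car: "a \<in> carrier_mat m m" "c \<in> carrier_mat m m" "b \<in> carrier_mat n n" "d \<in> carrier_mat n n"
    using p cone_carrier assms(1,2) by auto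
  have "mabs V (dsum (a - c) (b - d)) = dsum (mabs V (a - c)) (mabs V (b - d))"
    using car assms by (intro mabs_dsum[where m = m and n = m and r = n and s = n]) auto
  then show ?thesis
    using p car assms by (simp add: perp_def dsum_diff[of _ m m _ _ n n] dsum_add[of _ m m _ _ n n] cone_dsum)
qed

lemma mabs_adsum_star:
  assumes "m \<ge> 1" "n \<ge> 1" "v \<in> carrier_mat m n"
  shows "mabs V (adsum v (mstar V v)) = dsum (mabs V (mstar V v)) (mabs V v)"
  using assms by (intro mabs_adsum[of m n n m]) auto

text \<open>The dilations of \<open>x\<close> and \<open>y\<close> are self-adjoint with absolute
  values \<open>|x*| \<oplus> |x|\<close> and \<open>|y*| \<oplus> |y|\<close>, which are orthogonal
  by the two hypotheses. The self-adjoint case applies, and the lower diagonal block of its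
  conclusion is the claim.\<close>

lemma mabs_add_of_perp:
  assumes mn: "m \<ge> 1" "n \<ge> 1" and x: "x \<in> carrier_mat m n" and y: "y \<in> carrier_mat m n"
    and perp: "perp V n (mabs V x) (mabs V y)" "perp V m (mabs V (mstar V x)) (mabs V (mstar V y))"
  shows "mabs V (x + y) = mabs V x + mabs V y"
proof -
  let ?x = "adsum x (mstar V x)" and ?y = "adsum y (mstar V y)"
  have xs: "mstar V x \<in> carrier_mat n m" and ys: "mstar V y \<in> carrier_mat n m" using x y by auto
  have xy: "x + y \<in> carrier_mat m n" and xys: "mstar V (x + y) \<in> carrier_mat n m" using x y by auto
  note car = mabs_carrier[OF mn x] mabs_carrier[OF mn y] mabs_carrier[OF mn(2,1) xs]
    mabs_carrier[OF mn(2,1) ys] mabs_carrier[OF mn xy] mabs_carrier[OF mn(2,1) xys]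
  have "mabs V (?x + ?y) = mabs V ?x + mabs V ?y"
    using mn x y perp adsum_star_msa perp_dsum[OF mn perp(2,1)]
    by (intro mabs_add_of_perp_msa[of "m + n"]) (auto simp: mabs_adsum_star)
  also have "?x + ?y = adsum (x + y) (mstar V (x + y))"
    using x y by (simp add: adsum_add[of _ m n _ _ n m] mstar_add)
  finally have "dsum (mabs V (mstar V (x + y))) (mabs V (x + y)) =
    dsum (mabs V (mstar V x) + mabs V (mstar V y)) (mabs V x + mabs V y)"
    unfolding mabs_adsum_star[OF mn xy] mabs_adsum_star[OF mn x] mabs_adsum_star[OF mn y]
      dsum_add[OF car(3,4,1,2)] .
  then show ?thesis
    using dsum_eq_iff[OF car(6) add_carrier_mat[OF car(4)] car(5) add_carrier_mat[OF car(2)]] by blast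
qed

text \<open>The dilation has absolute value \<open>|x*| \<oplus> |x| = 0\<close>, so both it and its
  negative are positive, and it vanishes by properness.\<close>

lemma mabs_eq_zero:
  assumes mn: "m \<ge> 1" "n \<ge> 1" and x: "x \<in> carrier_mat m n"
    and "mabs V x = 0\<^sub>m n n" "mabs V (mstar V x) = 0\<^sub>m m m"
  shows "x = 0\<^sub>m m n"
proof -
  let ?x = "adsum x (mstar V x)"
  have mn1: "m + n \<ge> 1" using mn by simp
  have sa: "?x \<in> msa V (m + n)" using x by (rule adsum_star_msa)
  note car = msa_carrier[OF sa]
  have "dsum (0\<^sub>m m m) (0\<^sub>m n n) = (0\<^sub>m (m + n) (m + n) :: 'v mat)"
    by (rule eq_matI) auto
  then have z: "mabs V ?x = 0\<^sub>m (m + n) (m + n)"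
    using mabs_adsum_star[OF mn x] assms(4,5) by simp
  have "0\<^sub>m (m + n) (m + n) - ?x = - ?x" using car by (intro eq_matI) auto
  then have "?x = 0\<^sub>m (m + n) (m + n)"
    using mabs_add_cone[OF mn1 sa] mabs_diff_cone[OF mn1 sa] car
    by (intro cone_antisym_zero[OF mn1]) (auto simp: z)
  then have *: "?x $$ (i, j) = 0" if "i < m + n" "j < m + n" for i j using that by simp
  show ?thesis
  proof (rule eq_matI)
    fix i j assume "i < dim_row (0\<^sub>m m n :: 'v mat)" "j < dim_col (0\<^sub>m m n :: 'v mat)"
    \<comment> \<open>The entry \<open>(i, j)\<close> of \<open>x\<close> sits in column
      \<open>m + j\<close> of the dilation, behind the zero block of width \<open>m\<close>.\<close>
    then show "x $$ (i, j) = 0\<^sub>m m n $$ (i, j)" using *[of i "m + j"] x by auto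
  qed (use x in auto)
qed

section \<open>The matrix norm\<close>

lemma munit_1_cone: "munit V 1 \<in> mcone V 1"
  using matrix_order_unit unfolding matrix_order_unit_space_def by (elim conjE)

lemma msa_1_bound:
  assumes "v \<in> msa V 1"
  obtains k where "k > 0" "rsmul V k (munit V 1) - v \<in> mcone V 1"
proof -
  have "\<forall>v \<in> msa V 1. \<exists>k > 0. rsmul V k (munit V 1) + v \<in> mcone V 1 \<and>
                             rsmul V k (munit V 1) - v \<in> mcone V 1"
    using matrix_order_unit unfolding matrix_order_unit_space_def by (elim conjE)
  then show ?thesis using assms that by blast
qed

lemma munit_cone: "n \<ge> 1 \<Longrightarrow> munit V n \<in> mcone V n"
proof (induction n rule: nat_induct_at_least)
  case base
  show ?case by (rule munit_1_cone)
next
  case (Suc n)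
  show ?case using munit_1_cone cone_dsum[of n 1 "munit V n" "munit V 1"] Suc by (simp add: dsum_munit)
qed

lemma unit_bound_mono:
  assumes "n \<ge> 1" "k \<le> l" "x \<in> carrier_mat n n" "rsmul V k (munit V n) + x \<in> mcone V n"
  shows "rsmul V l (munit V n) + x \<in> mcone V n"
proof -
  have "rsmul V l (munit V n) + x = rsmul V (l - k) (munit V n) + (rsmul V k (munit V n) + x)"
    unfolding rsmul_left_diff using assms(3) by (intro eq_matI) auto
  then show ?thesis
    using assms by (simp add: cone_add[OF assms(1)] cone_rsmul munit_cone)
qed

text \<open>Conjugation by \<open>diag(1, ..., 1, -1)\<close> turns a positive block matrix \<open>[[a, b], [b*, c]]\<close> into
  \<open>[[a, -b], [-b*, c]]\<close>, whence it is at most \<open>2(a \<oplus> c)\<close>.\<close>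

lemma cone_le_unit:
  assumes "n \<ge> 1" "u \<in> mcone V n"
  shows "\<exists>k>0. rsmul V k (munit V n) - u \<in> mcone V n"
  using assms
proof (induction n arbitrary: u rule: nat_induct_at_least)
  case base
  then have "u \<in> msa V 1" by (simp add: cone_msa)
  then show ?case using msa_1_bound by metis
next
  case (Suc n)
  have Sn: "Suc n \<ge> 1" by simp
  have u: "u \<in> carrier_mat (Suc n) (Suc n)" using cone_carrier[OF Sn Suc.prems] .
  define a where "a = mat n n (\<lambda>(i, j). u $$ (i, j))"
  define c where "c = mat 1 1 (\<lambda>(i, j). u $$ (n, n))"
  define d where "d = mat (Suc n) (Suc n) (\<lambda>(i, j).
    if i < n \<longleftrightarrow> j < n then u $$ (i, j) else - u $$ (i, j))"
  have ac: "a \<in> carrier_mat n n" "c \<in> carrier_mat 1 1" "d \<in> carrier_mat (Suc n) (Suc n)"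
    by (auto simp: a_def c_def d_def)
  have "mat n n (\<lambda>(i, j). if i < Suc n \<and> j < Suc n
      then smul V (complex_of_real (1 * 1)) (u $$ (i, j)) else 0) \<in> mcone V n"
    using cone_select[OF Sn Suc.prems Suc.hyps, of "\<lambda>i. i" "\<lambda>_. 1"] .
  also have "mat n n (\<lambda>(i, j). if i < Suc n \<and> j < Suc n
      then smul V (complex_of_real (1 * 1)) (u $$ (i, j)) else 0) = a"
    by (rule eq_matI) (auto simp: a_def)
  finally have a: "a \<in> mcone V n" .
  have "mat 1 1 (\<lambda>(i, j). if n < Suc n \<and> n < Suc n
      then smul V (complex_of_real (1 * 1)) (u $$ (n, n)) else 0) \<in> mcone V 1"
    using cone_select[OF Sn Suc.prems, of 1 "\<lambda>i. n" "\<lambda>_. 1"] by simp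
  also have "mat 1 1 (\<lambda>(i, j). if n < Suc n \<and> n < Suc n
      then smul V (complex_of_real (1 * 1)) (u $$ (n, n)) else 0) = c"
    by (rule eq_matI) (auto simp: c_def)
  finally have c: "c \<in> mcone V 1" .
  let ?s = "\<lambda>i. if i < n then 1 else - 1 :: real"
  have "mat (Suc n) (Suc n) (\<lambda>(i, j). if i < Suc n \<and> j < Suc n
      then smul V (complex_of_real (?s i * ?s j)) (u $$ (i, j)) else 0) \<in> mcone V (Suc n)"
    using cone_select[OF Sn Suc.prems Sn, of "\<lambda>i. i" ?s] .
  also have "mat (Suc n) (Suc n) (\<lambda>(i, j). if i < Suc n \<and> j < Suc n
      then smul V (complex_of_real (?s i * ?s j)) (u $$ (i, j)) else 0) = d"
    by (rule eq_matI) (auto simp: d_def)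
  finally have d: "d \<in> mcone V (Suc n)" .
  obtain k where k: "k > 0" "rsmul V k (munit V n) - a \<in> mcone V n"
    using Suc.IH[OF a] by blast
  obtain l where l: "l > 0" "rsmul V l (munit V 1) - c \<in> mcone V 1"
    using msa_1_bound[OF cone_msa[OF _ c]] by auto
  define K where "K = max k l"
  have minus: "A - B = A + - B" if "A \<in> carrier_mat r r" "B \<in> carrier_mat r r" for A B :: "'v mat" and r
    using that by (intro eq_matI) auto
  have "rsmul V K (munit V n) - a \<in> mcone V n"
    using unit_bound_mono[OF Suc.hyps, of k K "- a"] k ac by (simp add: K_def minus[of _ n])
  moreover have "rsmul V K (munit V 1) - c \<in> mcone V 1"
    using unit_bound_mono[of 1 l K "- c"] l ac by (simp add: K_def minus[of _ 1])
  ultimately have D: "dsum (rsmul V K (munit V n) - a) (rsmul V K (munit V 1) - c) \<in> mcone V (Suc n)"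
    (is "?D \<in> _") using cone_dsum[of n 1] Suc.hyps by simp
  \<comment> \<open>On the diagonal blocks the right-hand side is twice \<open>K\<close> times the
    unit minus \<open>u\<close>, plus \<open>u\<close>; off the diagonal \<open>?D\<close> vanishes
    and \<open>d\<close> contributes \<open>-u\<close>.\<close>
  have "rsmul V (2 * K) (munit V (Suc n)) - u = (?D + ?D) + d"
    unfolding rsmul_rsmul[symmetric] rsmul_2
    using u by (intro eq_matI) (auto simp: a_def c_def d_def less_Suc_eq)
  then have "rsmul V (2 * K) (munit V (Suc n)) - u \<in> mcone V (Suc n)"
    using cone_add[OF Sn cone_add[OF Sn D D] d] by simp
  moreover have "2 * K > 0" using k by (simp add: K_def)
  ultimately show ?case by blast
qed

text \<open>Bounds for positive elements suffice: \<open>|x| + x\<close> is positive and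
  \<open>|x|\<close> lies below a multiple of the unit.\<close>

lemma msa_bound:
  assumes "n \<ge> 1" "x \<in> msa V n"
  shows "\<exists>k>0. rsmul V k (munit V n) + x \<in> mcone V n"
proof -
  have car: "x \<in> carrier_mat n n" "mabs V x \<in> carrier_mat n n"
    using msa_carrier[OF assms(2)] mabs_carrier[OF assms(1,1)] by auto
  obtain k where k: "k > 0" "rsmul V k (munit V n) - mabs V x \<in> mcone V n"
    using cone_le_unit[OF assms(1) mabs_cone[OF assms(1,1) car(1)]] by blast
  have "rsmul V k (munit V n) + x = (rsmul V k (munit V n) - mabs V x) + (mabs V x + x)"
    using car by (intro eq_matI) auto
  then show ?thesis using k cone_add[OF assms(1) k(2) mabs_add_cone[OF assms]] by auto
qed

context
  fixes n :: nat
  assumes n: "n \<ge> 1"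
begin

lemma cone_half: "rsmul V 2 v \<in> mcone V n \<Longrightarrow> v \<in> mcone V n"
  using cone_rsmul[OF n, of "1 / 2" "rsmul V 2 v"] by (simp add: rsmul_rsmul)

lemma n_plus_n: "n + n \<ge> 1"
  using n by simp

text \<open>The block matrix of \<open>mnorm\<close> is split as a multiple of the unit plus a
  self-adjoint dilation, the form to which \<open>msa_bound\<close> and
  \<open>unit_bound_mono\<close> apply.\<close>

definition norm_bounds :: "'v mat \<Rightarrow> real set" where
  "norm_bounds v = {k. k > 0 \<and> rsmul V k (munit V (n + n)) + adsum v (mstar V v) \<in> mcone V (n + n)}"

lemma mnorm_eq_Inf:
  assumes "v \<in> carrier_mat n n"
  shows "mnorm V n v = Inf (norm_bounds v)"
proof -
  have "four_block_mat (rsmul V k (munit V n)) v (mstar V v) (rsmul V k (munit V n)) =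
    rsmul V k (munit V (n + n)) + adsum v (mstar V v)" for k
    using assms by (intro eq_matI) auto
  then show ?thesis by (simp add: mnorm_def norm_bounds_def mult_2)
qed

text \<open>This rules out that \<open>Inf\<close> in \<open>mnorm\<close> is taken over the empty
  set, where its value would carry no information.\<close>

lemma norm_bounds_nonempty: "v \<in> carrier_mat n n \<Longrightarrow> norm_bounds v \<noteq> {}"
  using msa_bound[OF n_plus_n adsum_star_msa[of v n n]] by (auto simp: norm_bounds_def)

lemma mnorm_nonneg: "v \<in> carrier_mat n n \<Longrightarrow> mnorm V n v \<ge> 0"
  using norm_bounds_nonempty by (auto simp: mnorm_eq_Inf norm_bounds_def intro!: cInf_greatest)

text \<open>Some admissible constant lies below \<open>k\<close>, and admissibility passes to larger
  constants.\<close>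

lemma mnorm_less_bound:
  assumes "v \<in> carrier_mat n n" "mnorm V n v < k"
  shows "rsmul V k (munit V (n + n)) + adsum v (mstar V v) \<in> mcone V (n + n)"
proof -
  obtain l where "l \<in> norm_bounds v" "l < k"
    using cInf_lessD[OF norm_bounds_nonempty] assms by (auto simp: mnorm_eq_Inf)
  then show ?thesis
    using assms by (intro unit_bound_mono[OF n_plus_n, of l k]) (auto simp: norm_bounds_def)
qed

text \<open>Only constants strictly above \<open>c\<close> are tested, so that \<open>c = 0\<close>
  is allowed although admissible constants are positive.\<close>

lemma mnorm_leI:
  assumes "v \<in> carrier_mat n n" "c \<ge> 0"
    and "\<And>k. k > c \<Longrightarrow> rsmul V k (munit V (n + n)) + adsum v (mstar V v) \<in> mcone V (n + n)"
  shows "mnorm V n v \<le> c"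
proof (rule dense_ge)
  fix k assume "k > c"
  then have "k \<in> norm_bounds v" using assms by (auto simp: norm_bounds_def)
  then show "mnorm V n v \<le> k"
    using assms by (auto simp: mnorm_eq_Inf norm_bounds_def intro!: cInf_lower bdd_belowI[of _ 0])
qed

text \<open>With \<open>e\<close> the unit of size \<open>n\<close>, compression of
  \<open>[[ke, s], [s, ke]]\<close> by \<open>[1; -1]\<close> gives \<open>2(ke - s)\<close>.
  Conversely that block matrix is \<open>[[s, s], [s, s]]\<close> plus
  \<open>(ke - s) \<oplus> (ke - s)\<close>, and the first summand is a compression of
  \<open>s\<close>.\<close>

lemma cone_bound_iff:
  assumes s: "s \<in> mcone V n"
  shows "rsmul V k (munit V (n + n)) + adsum s s \<in> mcone V (n + n) \<longleftrightarrow> rsmul V k (munit V n) - s \<in> mcone V n"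
    (is "?M \<in> _ \<longleftrightarrow> ?D \<in> _")
proof
  have car: "s \<in> carrier_mat n n" using cone_carrier[OF n s] .
  assume "?M \<in> mcone V (n + n)"
  from cone_block_diff[OF n this]
  have "mat n n (\<lambda>(i, j). ?M $$ (i, j) - ?M $$ (i, n + j) - ?M $$ (n + i, j) + ?M $$ (n + i, n + j))
    \<in> mcone V n" .
  also have "mat n n (\<lambda>(i, j). ?M $$ (i, j) - ?M $$ (i, n + j) - ?M $$ (n + i, j) + ?M $$ (n + i, n + j))
    = rsmul V 2 ?D"
    unfolding rsmul_2 using car by (intro eq_matI) auto
  finally show "?D \<in> mcone V n" by (rule cone_half)
next
  have car: "s \<in> carrier_mat n n" using cone_carrier[OF n s] .
  assume D: "?D \<in> mcone V n"
  let ?f = "\<lambda>i. if i < n then i else i - n"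
  let ?S = "mat (n + n) (n + n) (\<lambda>(i, j). if ?f i < n \<and> ?f j < n
      then smul V (complex_of_real (1 * 1)) (s $$ (?f i, ?f j)) else 0)"
  have "?S \<in> mcone V (n + n)"
    using cone_select[OF n s n_plus_n, of ?f "\<lambda>_. 1"] .
  moreover have "?M = ?S + dsum ?D ?D"
    using car by (intro eq_matI) auto
  ultimately show "?M \<in> mcone V (n + n)"
    using cone_add[OF n_plus_n _ cone_dsum[OF n n D D]] by simp
qed

lemma cone_mnorm_le_one_iff:
  assumes s: "s \<in> mcone V n"
  shows "mnorm V n s \<le> 1 \<longleftrightarrow> munit V n - s \<in> mcone V n"
proof
  have car: "s \<in> carrier_mat n n" using cone_carrier[OF n s] .
  have ss: "mstar V s = s" using cone_star[OF n s] .
  {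
    assume le: "mnorm V n s \<le> 1"
    \<comment> \<open>The norm gives bounds only for constants above 1; the Archimedean property
      reaches the constant 1 itself.\<close>
    show "munit V n - s \<in> mcone V n"
    proof (rule archimedean[OF n munit_cone[OF n]])
      show "munit V n - s \<in> msa V n"
        using s by (intro msa_diff cone_msa[OF n] munit_cone[OF n])
      fix k :: real assume "k > 0"
      then have "rsmul V (k + 1) (munit V n) - s \<in> mcone V n"
        using mnorm_less_bound[OF car, of "k + 1"] le cone_bound_iff[OF s] by (simp add: ss)
      also have "rsmul V (k + 1) (munit V n) - s = rsmul V k (munit V n) + (munit V n - s)"
        unfolding rsmul_left_distrib using car by (intro eq_matI) auto
      finally show "rsmul V k (munit V n) + (munit V n - s) \<in> mcone V n" .
    qed
  }
  assume le: "munit V n - s \<in> mcone V n"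
  show "mnorm V n s \<le> 1"
  proof (rule mnorm_leI[OF car])
    fix k :: real assume k: "k > 1"
    have "rsmul V k (munit V n) - s = rsmul V (k - 1) (munit V n) + (munit V n - s)"
      unfolding rsmul_left_diff using car by (intro eq_matI) auto
    then have "rsmul V k (munit V n) - s \<in> mcone V n"
      using cone_add[OF n cone_rsmul[OF n _ munit_cone[OF n], of "k - 1"] le] k by simp
    then show "rsmul V k (munit V (n + n)) + adsum s (mstar V s) \<in> mcone V (n + n)"
      using cone_bound_iff[OF s] by (simp add: ss)
  qed simp
qed

text \<open>Axiom (4), read for \<open>p\<close> and \<open>q\<close> themselves with both
  coefficients 1, makes the norm of \<open>p + q\<close> the larger of the two norms, hence at most
  1.\<close>

lemma perp_sum_le_unit:
  assumes "perp V n p q" "munit V n - p \<in> mcone V n" "munit V n - q \<in> mcone V n"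
  shows "munit V n - (p + q) \<in> mcone V n"
proof -
  note c = perp_cone[OF assms(1)]
  note car = cone_carrier[OF n c(1)] cone_carrier[OF n c(2)]
  have "\<forall>n \<ge> 1. \<forall>u \<in> mcone V n. \<forall>v \<in> mcone V n. perp V n u v \<longleftrightarrow> perp_inf_abs V n u v"
    using V unfolding abs_matrix_order_unit_space_def by (elim conjE)
  then have "perp_inf_abs V n p q" using n c assms by blast
  moreover have "p - p = 0\<^sub>m n n" "q - q = 0\<^sub>m n n" using car by auto
  ultimately have "perp_inf V n p q"
    using c car n by (auto simp: perp_inf_abs_def mle_def mat_minus_zero)
  then have "mnorm V n (rsmul V 1 p + rsmul V 1 q) = max (mnorm V n (rsmul V 1 p)) (mnorm V n (rsmul V 1 q))"
    unfolding perp_inf_def by blast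
  then have "mnorm V n (p + q) \<le> 1"
    using assms c by (simp add: cone_mnorm_le_one_iff)
  then show ?thesis using c by (simp add: cone_mnorm_le_one_iff cone_add[OF n])
qed

section \<open>Order projections\<close>

text \<open>With \<open>e\<close> the unit, \<open>p - (e - p) = 2p - e\<close> and
  \<open>p + (e - p) = e\<close>. Positivity of \<open>p\<close> and of \<open>e - p\<close> comes
  from \<open>|2p - e| \<plusminus> (2p - e)\<close> being positive.\<close>

lemma OP_iff: "p \<in> OP V n \<longleftrightarrow> perp V n p (munit V n - p)"
proof
  assume p: "p \<in> OP V n"
  then have car: "p \<in> carrier_mat n n" and star: "mstar V p = p"
    and abs: "mabs V (rsmul V 2 p - munit V n) = munit V n"
    by (auto simp: OP_def)
  have "munit V n \<in> msa V n" "p \<in> msa V n"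
    using munit_cone[OF n] cone_msa[OF n] car star by (auto simp: msa_def)
  then have sa: "rsmul V 2 p - munit V n \<in> msa V n" by (intro msa_diff msa_rsmul)
  have "munit V n + (rsmul V 2 p - munit V n) = rsmul V 2 p"
    "munit V n - (rsmul V 2 p - munit V n) = rsmul V 2 (munit V n - p)"
    "p - (munit V n - p) = rsmul V 2 p - munit V n" "p + (munit V n - p) = munit V n"
    unfolding rsmul_2 using car by (auto intro!: eq_matI)
  then show "perp V n p (munit V n - p)"
    using mabs_add_cone[OF n sa] mabs_diff_cone[OF n sa] cone_half abs by (simp add: perp_def)
next
  assume perp: "perp V n p (munit V n - p)"
  note c = perp_cone[OF perp]
  note car = cone_carrier[OF n c(1)]
  have "p - (munit V n - p) = rsmul V 2 p - munit V n" "p + (munit V n - p) = munit V n"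
    unfolding rsmul_2 using car by (auto intro!: eq_matI)
  then show "p \<in> OP V n" using c car cone_star[OF n c(1)] by (simp add: OP_def)
qed

lemma OP_cone: "p \<in> OP V n \<Longrightarrow> p \<in> mcone V n"
  and OP_le_unit: "p \<in> OP V n \<Longrightarrow> munit V n - p \<in> mcone V n"
  by (auto simp: OP_iff perp_def)

text \<open>The complement \<open>e - (p + q)\<close> is positive by the norm argument. It lies
  below both \<open>e - p\<close> and \<open>e - q\<close>, so it is orthogonal to \<open>p\<close>
  and to \<open>q\<close>, hence to their sum.\<close>

lemma OP_add_of_perp:
  assumes "p \<in> OP V n" "q \<in> OP V n" "perp V n p q"
  shows "p + q \<in> OP V n"
proof -
  let ?e = "munit V n"
  note c = perp_cone[OF assms(3)]
  note car = cone_carrier[OF n c(1)] cone_carrier[OF n c(2)]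
  have le: "?e - (p + q) \<in> mcone V n"
    using assms by (intro perp_sum_le_unit OP_le_unit)
  have "(?e - p) - (?e - (p + q)) = q" "(?e - q) - (?e - (p + q)) = p"
    using car by (auto intro!: eq_matI)
  then have "perp V n p (?e - (p + q))" "perp V n q (?e - (p + q))"
    using assms le c by (auto simp: OP_iff intro: perp_mono_right[OF n])
  then have "perp V n (p + q) (?e - (p + q))"
    using perp_add_right[OF n] perp_sym[OF n] by blast
  then show ?thesis by (simp add: OP_iff)
qed

text \<open>If the norm were below some \<open>k < 1\<close>, then \<open>p\<close> would lie below
  \<open>ke\<close>, whence \<open>(1 - k)p\<close> lies below \<open>e - p\<close> and is
  orthogonal to \<open>p\<close>. This reads \<open>|kp| = (2 - k)p\<close>, that is
  \<open>kp = (2 - k)p\<close>, and forces \<open>p = 0\<close>.\<close>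

lemma OP_mnorm_ge_one:
  assumes p: "p \<in> OP V n" and nz: "p \<noteq> 0\<^sub>m n n"
  shows "mnorm V n p \<ge> 1"
proof (rule ccontr)
  assume "\<not> ?thesis"
  then obtain k where k: "mnorm V n p < k" "k < 1"
    using dense[of "mnorm V n p" 1] by (auto simp: not_le)
  have pc: "p \<in> mcone V n" using OP_cone[OF p] .
  have car: "p \<in> carrier_mat n n" using cone_carrier[OF n pc] .
  have k0: "k > 0" using mnorm_nonneg[OF car] k by simp
  have kp: "rsmul V k (munit V n) - p \<in> mcone V n"
    using mnorm_less_bound[OF car k(1)] cone_bound_iff[OF pc] cone_star[OF n pc] by simp
  have "(munit V n - p) - rsmul V (1 - k) p = rsmul V (1 - k) (munit V n - p) + (rsmul V k (munit V n) - p)"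
    unfolding rsmul_left_diff using car by (intro eq_matI) (auto simp: vs.scale_right_diff_distrib)
  then have "(munit V n - p) - rsmul V (1 - k) p \<in> mcone V n"
    using cone_add[OF n cone_rsmul[OF n _ OP_le_unit[OF p], of "1 - k"] kp] k by simp
  then have "perp V n p (rsmul V (1 - k) p)"
    using perp_mono_right[OF n p[unfolded OP_iff] cone_rsmul[OF n _ pc]] k by simp
  then have "mabs V (p - rsmul V (1 - k) p) = p + rsmul V (1 - k) p" by (rule perp_cone)
  moreover have "p - rsmul V (1 - k) p = rsmul V k p"
    unfolding rsmul_left_diff using car by (intro eq_matI) auto
  moreover have "mabs V (rsmul V k p) = rsmul V k p"
    using k0 pc by (simp add: mabs_of_cone[OF n] cone_rsmul[OF n])
  moreover have "p + rsmul V (1 - k) p = rsmul V (2 - k) p"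
    using rsmul_left_distrib[of 1 "1 - k" p] by simp
  ultimately have eq: "rsmul V (2 - k) p = rsmul V k p" by simp
  have "rsmul V (2 - k - k) p = rsmul V (2 - k) p - rsmul V k p" by (rule rsmul_left_diff)
  also have "\<dots> = 0\<^sub>m n n" unfolding eq using car by (intro eq_matI) auto
  also have "\<dots> = rsmul V (2 - k - k) (0\<^sub>m n n)" by (rule eq_matI) auto
  finally have "p = 0\<^sub>m n n" by (rule rsmul_cancel[rotated]) (use k in simp)
  then show False using nz by simp
qed

lemma OP_carrier: "p \<in> OP V n \<Longrightarrow> p \<in> carrier_mat n n"
  and OP_star: "p \<in> OP V n \<Longrightarrow> mstar V p = p"
  by (auto simp: OP_def)

lemma OP_mabs: "p \<in> OP V n \<Longrightarrow> mabs V p = p"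
  using mabs_of_cone[OF n OP_cone] .

lemma OP_zero: "0\<^sub>m n n \<in> OP V n"
proof -
  have *: "0\<^sub>m n n - munit V n = - munit V n" "0\<^sub>m n n + munit V n = munit V n"
    "munit V n - 0\<^sub>m n n = munit V n"
    by (auto intro!: eq_matI)
  have "mabs V (rsmul V (- 1) (munit V n)) = munit V n"
    using munit_cone[OF n] by (simp add: mabs_rsmul[OF n] cone_msa[OF n] mabs_of_cone[OF n])
  then show ?thesis
    using munit_cone[OF n] by (simp add: OP_iff perp_def * rsmul_minus_1 cone_zero[OF n])
qed

lemma OP_munit: "munit V n \<in> OP V n"
proof -
  have eqs: "munit V n - munit V n = 0\<^sub>m n n" "munit V n - 0\<^sub>m n n = munit V n"
    "munit V n + 0\<^sub>m n n = munit V n"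
    by (auto intro!: eq_matI)
  show ?thesis
    unfolding OP_iff perp_def eqs
    using munit_cone[OF n] by (simp add: mabs_of_cone[OF n] cone_zero[OF n])
qed

end

lemma OP_dsum:
  assumes "m \<ge> 1" "n \<ge> 1" "p \<in> OP V m" "q \<in> OP V n"
  shows "dsum p q \<in> OP V (m + n)"
proof -
  have "perp V (m + n) (dsum p q) (dsum (munit V m - p) (munit V n - q))"
    using assms by (intro perp_dsum) (auto simp: OP_iff)
  also have "dsum (munit V m - p) (munit V n - q) = munit V (m + n) - dsum p q"
    using assms OP_carrier by (simp add: dsum_diff[of _ m m _ _ n n, symmetric] dsum_munit)
  finally show ?thesis using assms by (simp add: OP_iff)
qed

section \<open>Equivalence of projections\<close>

lemma OP_infE:
  assumes "p \<in> OP_inf V"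
  obtains n where "n \<ge> 1" "p \<in> OP V n"
  using assms by (auto simp: OP_inf_def)

lemma OP_infI: "n \<ge> 1 \<Longrightarrow> p \<in> OP V n \<Longrightarrow> p \<in> OP_inf V"
  by (auto simp: OP_inf_def)

lemma OP_inf_size:
  assumes "p \<in> OP_inf V" "p \<in> carrier_mat n n"
  shows "n \<ge> 1 \<and> p \<in> OP V n"
proof -
  obtain m where m: "m \<ge> 1" "p \<in> OP V m" using OP_infE[OF assms(1)] .
  then have "m = n" using OP_carrier[OF m] assms(2) by auto
  with m show ?thesis by simp
qed

lemma OP_inf_dsum: "p \<in> OP_inf V \<Longrightarrow> q \<in> OP_inf V \<Longrightarrow> dsum p q \<in> OP_inf V"
  by (elim OP_infE) (rule OP_infI[OF _ OP_dsum], auto)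

lemma OP_inf_zero: "n \<ge> 1 \<Longrightarrow> 0\<^sub>m n n \<in> OP_inf V"
  using OP_infI OP_zero by blast

lemma proj_simI:
  assumes "m \<ge> 1" "n \<ge> 1" "v \<in> carrier_mat m n"
    and "mabs V (mstar V v) = p" "mabs V v = q" "p \<in> OP V m" "q \<in> OP V n"
  shows "proj_sim V p q"
  unfolding proj_sim_def PI_def using assms by blast

lemma proj_simE:
  assumes "proj_sim V p q"
  obtains m n v where "m \<ge> 1" "n \<ge> 1" "v \<in> PI V m n" "v \<in> carrier_mat m n"
    "mabs V (mstar V v) = p" "mabs V v = q" "p \<in> OP V m" "q \<in> OP V n"
  using assms unfolding proj_sim_def PI_def by blast

lemma proj_sim_refl:
  assumes "p \<in> OP_inf V"
  shows "proj_sim V p p"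
proof -
  obtain n where n: "n \<ge> 1" "p \<in> OP V n" using OP_infE[OF assms] .
  then show ?thesis
    using OP_carrier OP_star OP_mabs by (intro proj_simI[of n n p]) auto
qed

lemma proj_sim_sym:
  assumes "proj_sim V p q"
  shows "proj_sim V q p"
  using assms
proof (rule proj_simE)
  fix m n v
  assume "m \<ge> 1" "n \<ge> 1" "v \<in> carrier_mat m n"
    "mabs V (mstar V v) = p" "mabs V v = q" "p \<in> OP V m" "q \<in> OP V n"
  then show ?thesis by (intro proj_simI[of n m "mstar V v"]) auto
qed

lemma proj_sim_dsum:
  assumes "proj_sim V p q" "proj_sim V p' q'"
  shows "proj_sim V (dsum p p') (dsum q q')"
proof -
  obtain m n v where v: "m \<ge> 1" "n \<ge> 1" "v \<in> carrier_mat m n"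
    "mabs V (mstar V v) = p" "mabs V v = q" "p \<in> OP V m" "q \<in> OP V n"
    using proj_simE[OF assms(1)] .
  obtain m' n' v' where v': "m' \<ge> 1" "n' \<ge> 1" "v' \<in> carrier_mat m' n'"
    "mabs V (mstar V v') = p'" "mabs V v' = q'" "p' \<in> OP V m'" "q' \<in> OP V n'"
    using proj_simE[OF assms(2)] .
  show ?thesis
  proof (rule proj_simI[of "m + m'" "n + n'" "dsum v v'"])
    show "mabs V (mstar V (dsum v v')) = dsum p p'"
      unfolding mstar_dsum v(4)[symmetric] v'(4)[symmetric]
      using v(1-3) v'(1-3) by (intro mabs_dsum[of n m n' m']) auto
    show "mabs V (dsum v v') = dsum q q'"
      unfolding v(5)[symmetric] v'(5)[symmetric]
      using v(1-3) v'(1-3) by (intro mabs_dsum[of m n m' n']) auto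
  qed (use v v' OP_dsum in auto)
qed

text \<open>The partial isometry is \<open>[[0, p], [q, 0]]\<close>, whose adjoint is
  \<open>[[0, q], [p, 0]]\<close>.\<close>

lemma proj_sim_comm:
  assumes "p \<in> OP_inf V" "q \<in> OP_inf V"
  shows "proj_sim V (dsum p q) (dsum q p)"
proof -
  obtain m where m: "m \<ge> 1" "p \<in> OP V m" using OP_infE[OF assms(1)] .
  obtain n where n: "n \<ge> 1" "q \<in> OP V n" using OP_infE[OF assms(2)] .
  note car = OP_carrier[OF m] OP_carrier[OF n]
  have s: "mstar V p = p" "mstar V q = q" "mabs V p = p" "mabs V q = q"
    using m n by (auto simp: OP_star OP_mabs)
  show ?thesis
  proof (rule proj_simI[of "m + n" "n + m" "adsum p q"])
    show "mabs V (mstar V (adsum p q)) = dsum p q"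
      using mabs_adsum[of n n m m q p] m n car by (simp add: mstar_adsum s)
    show "mabs V (adsum p q) = dsum q p"
      using mabs_adsum[of m m n n p q] m n car by (simp add: s)
  qed (use m n car OP_dsum in auto)
qed

text \<open>The rectangular zero matrix is the partial isometry. Thus zero blocks of any size can
  later be traded for the one of size 1.\<close>

lemma proj_sim_zero:
  assumes "m \<ge> 1" "n \<ge> 1"
  shows "proj_sim V (0\<^sub>m m m) (0\<^sub>m n n)"
  using assms by (intro proj_simI[of m n "0\<^sub>m m n"]) (auto simp: mabs_zero OP_zero)

text \<open>The partial isometry is \<open>[[p, q], [0, 0]] = (p \<oplus> 0) + [[0, q], [0, 0]]\<close>, a sum of two
  orthogonal ones.\<close>

lemma proj_sim_add_of_perp:
  assumes n: "n \<ge> 1" and p: "p \<in> OP V n" and q: "q \<in> OP V n" and perp: "perp V n p q"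
  shows "proj_sim V (dsum (p + q) (0\<^sub>m n n)) (dsum p q)"
proof -
  let ?z = "0\<^sub>m n n :: 'v mat"
  let ?x = "dsum p ?z" and ?y = "adsum q ?z"
  have nn: "n + n \<ge> 1" using n by simp
  note car = OP_carrier[OF n p] OP_carrier[OF n q]
  have z: "?z \<in> carrier_mat n n" by simp
  have s: "mstar V p = p" "mstar V q = q" "mabs V p = p" "mabs V q = q" "mabs V ?z = ?z"
    using n p q by (auto simp: OP_star OP_mabs mabs_zero)
  have xy: "?x \<in> carrier_mat (n + n) (n + n)" "?y \<in> carrier_mat (n + n) (n + n)"
    using car by auto
  have ys: "mstar V ?y = adsum ?z q" by (simp add: mstar_adsum s)
  have xs: "mstar V ?x = ?x" by (simp add: mstar_dsum s)
  have ax: "mabs V ?x = ?x" using mabs_dsum[OF n n n n car(1) z] by (simp add: s)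
  have ay: "mabs V ?y = dsum ?z q" using mabs_adsum[OF n n n n car(2) z] by (simp add: s)
  have ays: "mabs V (mstar V ?y) = dsum q ?z"
    using mabs_adsum[OF n n n n z car(2)] by (simp add: s ys)
  have pz: "perp V n p ?z"
    using perp_mono_right[OF n perp cone_zero[OF n]] perp_cone(2)[OF perp] car
    by (simp add: mat_minus_zero)
  have zq: "perp V n ?z q"
    using perp_mono_right[OF n perp_sym[OF n perp] cone_zero[OF n]] perp_cone(1)[OF perp] car
      perp_sym[OF n] by (simp add: mat_minus_zero)
  have zz: "perp V n ?z ?z"
    using perp_mono_right[OF n zq cone_zero[OF n]] perp_cone(2)[OF perp] car
    by (simp add: mat_minus_zero)
  \<comment> \<open>Orthogonality is checked blockwise: \<open>p \<oplus> 0\<close> against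
    \<open>0 \<oplus> q\<close> for the absolute values, and \<open>p \<oplus> 0\<close> against
    \<open>q \<oplus> 0\<close> for those of the adjoints. The latter is where \<open>p\<close>
    meets \<open>q\<close>.\<close>
  have "mabs V (?x + ?y) = ?x + dsum ?z q"
    using mabs_add_of_perp[OF nn nn xy] perp_dsum[OF n n pz zq] perp_dsum[OF n n perp zz]
    by (simp add: ax ay ays xs)
  moreover have "?x + dsum ?z q = dsum p q" using car by (intro eq_matI) auto
  moreover have "mabs V (mstar V (?x + ?y)) = ?x + dsum q ?z"
  proof -
    have "mstar V (?x + ?y) = ?x + mstar V ?y" using xy by (simp add: mstar_add xs)
    moreover have "mabs V (?x + mstar V ?y) = ?x + dsum q ?z"
      using mabs_add_of_perp[OF nn nn xy(1), of "mstar V ?y"] xy(2)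
        perp_dsum[OF n n perp zz] perp_dsum[OF n n pz zq]
      by (simp add: ax ay ays xs)
    ultimately show ?thesis by simp
  qed
  moreover have "?x + dsum q ?z = dsum (p + q) ?z" using car by (intro eq_matI) auto
  ultimately show ?thesis
    using xy n p q perp nn
    by (intro proj_simI[of "n + n" "n + n" "?x + ?y"]) (auto intro!: OP_dsum OP_add_of_perp OP_zero)
qed

end

section \<open>Stable equivalence under condition (T)\<close>

locale abs_matrix_order_unit_T = abs_matrix_order_unit V
  for V :: "('v::ab_group_add, 'z) matrix_space_scheme" +
  assumes T: "condition_T V"
begin

text \<open>Condition (T) joins two partial isometries with the same initial projection. The second
  equivalence is therefore reversed first, so that \<open>q\<close> becomes the initial projection
  of both.\<close>

lemma proj_sim_trans:
  assumes "proj_sim V p q" "proj_sim V q r"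
  shows "proj_sim V p r"
proof -
  obtain m n u where u: "m \<ge> 1" "n \<ge> 1" "u \<in> PI V m n"
    "mabs V (mstar V u) = p" "mabs V u = q" "p \<in> OP V m" "q \<in> OP V n"
    using proj_simE[OF assms(1)] .
  obtain n' l v where v: "n' \<ge> 1" "l \<ge> 1" "v \<in> PI V l n'"
    "mabs V v = q" "mabs V (mstar V v) = r" "r \<in> OP V l" "q \<in> OP V n'"
    by (rule proj_simE[OF proj_sim_sym[OF assms(2)]])
  have n': "n' = n" using OP_carrier[OF u(2,7)] OP_carrier[OF v(1,7)] by auto
  have "\<exists>w \<in> PI V m l. mabs V (mstar V w) = mabs V (mstar V u) \<and> mabs V w = mabs V (mstar V v)"
    by (rule T[unfolded condition_T_def, rule_format, OF u(1,2) v(2) u(3)])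
      (use u(5) v(3,4) n' in auto)
  then obtain w where "w \<in> PI V m l" "mabs V (mstar V w) = mabs V (mstar V u)"
    "mabs V w = mabs V (mstar V v)" by blast
  then show ?thesis
    using u v by (intro proj_simI[of m l w]) (auto simp: PI_def)
qed

lemma proj_approx_OP_inf: "proj_approx V p q \<Longrightarrow> p \<in> OP_inf V \<and> q \<in> OP_inf V"
  by (simp add: proj_approx_def)

lemma proj_approx_of_sim:
  assumes "p \<in> OP_inf V" "q \<in> OP_inf V" "proj_sim V p q"
  shows "proj_approx V p q"
  unfolding proj_approx_def
  using assms proj_sim_dsum[OF assms(3) proj_sim_refl[OF assms(1)]] by blast

lemma proj_approx_refl: "p \<in> OP_inf V \<Longrightarrow> proj_approx V p p"
  by (simp add: proj_approx_of_sim proj_sim_refl)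

lemma proj_approx_sym: "proj_approx V p q \<Longrightarrow> proj_approx V q p"
  unfolding proj_approx_def using proj_sim_sym by blast

lemma proj_approx_comm: "p \<in> OP_inf V \<Longrightarrow> q \<in> OP_inf V \<Longrightarrow> proj_approx V (dsum p q) (dsum q p)"
  by (simp add: proj_approx_of_sim OP_inf_dsum proj_sim_comm)

text \<open>If \<open>r\<close> and \<open>s\<close> stabilize the two equivalences,
  \<open>r \<oplus> s\<close> stabilizes the composite; the summands are only permuted in
  between.\<close>

lemma proj_approx_trans:
  assumes "proj_approx V p q" "proj_approx V q t"
  shows "proj_approx V p t"
proof -
  obtain r where r: "r \<in> OP_inf V" "proj_sim V (dsum p r) (dsum q r)"
    using assms(1) by (auto simp: proj_approx_def)
  obtain s where s: "s \<in> OP_inf V" "proj_sim V (dsum q s) (dsum t s)"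
    using assms(2) by (auto simp: proj_approx_def)
  have P: "p \<in> OP_inf V" "q \<in> OP_inf V" "t \<in> OP_inf V"
    using assms proj_approx_OP_inf by auto
  have rs: "proj_sim V (dsum r s) (dsum s r)" "proj_sim V (dsum s r) (dsum r s)"
    using r s proj_sim_comm by auto
  have "proj_sim V (dsum p (dsum r s)) (dsum q (dsum r s))"
    using proj_sim_dsum[OF r(2) proj_sim_refl[OF s(1)]] by (simp only: dsum_assoc)
  moreover have "proj_sim V (dsum q (dsum r s)) (dsum q (dsum s r))"
    by (rule proj_sim_dsum[OF proj_sim_refl[OF P(2)] rs(1)])
  moreover have "proj_sim V (dsum q (dsum s r)) (dsum t (dsum s r))"
    using proj_sim_dsum[OF s(2) proj_sim_refl[OF r(1)]] by (simp only: dsum_assoc)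
  moreover have "proj_sim V (dsum t (dsum s r)) (dsum t (dsum r s))"
    by (rule proj_sim_dsum[OF proj_sim_refl[OF P(3)] rs(2)])
  ultimately have "proj_sim V (dsum p (dsum r s)) (dsum t (dsum r s))"
    using proj_sim_trans by blast
  then show ?thesis
    unfolding proj_approx_def using P OP_inf_dsum[OF r(1) s(1)] by blast
qed

lemma proj_approx_dsum_right:
  assumes "proj_approx V p q" "t \<in> OP_inf V"
  shows "proj_approx V (dsum p t) (dsum q t)"
proof -
  obtain r where r: "r \<in> OP_inf V" "proj_sim V (dsum p r) (dsum q r)"
    using assms(1) by (auto simp: proj_approx_def)
  have P: "p \<in> OP_inf V" "q \<in> OP_inf V" using assms proj_approx_OP_inf by auto
  have "proj_sim V (dsum p (dsum t r)) (dsum p (dsum r t))"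
    using proj_sim_dsum[OF proj_sim_refl[OF P(1)] proj_sim_comm[OF assms(2) r(1)]] .
  moreover have "proj_sim V (dsum p (dsum r t)) (dsum q (dsum r t))"
    using proj_sim_dsum[OF r(2) proj_sim_refl[OF assms(2)]] by (simp only: dsum_assoc)
  moreover have "proj_sim V (dsum q (dsum r t)) (dsum q (dsum t r))"
    using proj_sim_dsum[OF proj_sim_refl[OF P(2)] proj_sim_comm[OF r(1) assms(2)]] .
  ultimately have "proj_sim V (dsum (dsum p t) r) (dsum (dsum q t) r)"
    unfolding dsum_assoc using proj_sim_trans by blast
  then show ?thesis
    unfolding proj_approx_def using P assms(2) r(1) OP_inf_dsum by blast
qed

lemma proj_approx_dsum:
  assumes "proj_approx V p q" "proj_approx V s t"
  shows "proj_approx V (dsum p s) (dsum q t)"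
proof -
  have P: "p \<in> OP_inf V" "q \<in> OP_inf V" "s \<in> OP_inf V" "t \<in> OP_inf V"
    using assms proj_approx_OP_inf by auto
  have "proj_approx V (dsum p s) (dsum q s)" using assms P by (intro proj_approx_dsum_right)
  moreover have "proj_approx V (dsum q s) (dsum s q)" using P by (intro proj_approx_comm)
  moreover have "proj_approx V (dsum s q) (dsum t q)" using assms P by (intro proj_approx_dsum_right)
  moreover have "proj_approx V (dsum t q) (dsum q t)" using P by (intro proj_approx_comm)
  ultimately show ?thesis using proj_approx_trans by blast
qed

text \<open>The summand to be cancelled is absorbed into the stabilizing projection, which becomes
  \<open>t \<oplus> r\<close>.\<close>

lemma proj_approx_cancel:
  assumes "proj_approx V (dsum p t) (dsum q t)" "p \<in> OP_inf V" "q \<in> OP_inf V" "t \<in> OP_inf V"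
  shows "proj_approx V p q"
proof -
  obtain r where r: "r \<in> OP_inf V" "proj_sim V (dsum (dsum p t) r) (dsum (dsum q t) r)"
    using assms(1) by (auto simp: proj_approx_def)
  then show ?thesis
    unfolding proj_approx_def dsum_assoc using assms OP_inf_dsum by blast
qed

section \<open>The cancellative commutative addition of stable classes\<close>

definition iso_class :: "'v mat \<Rightarrow> 'v mat set" where
  "iso_class p = {q. proj_approx V p q}"

text \<open>Addition is defined on arbitrary sets, so that it is associative and commutative without
  side conditions and can be used for rewriting.\<close>

definition class_add :: "'v mat set \<Rightarrow> 'v mat set \<Rightarrow> 'v mat set" (infixl "\<boxplus>" 65) where
  "A \<boxplus> B = {c. \<exists>a \<in> A \<inter> OP_inf V. \<exists>b \<in> B \<inter> OP_inf V. proj_approx V c (dsum a b)}"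

lemma class_add_commute: "A \<boxplus> B = B \<boxplus> A"
proof -
  have "A \<boxplus> B \<subseteq> B \<boxplus> A" for A B
  proof
    fix c assume "c \<in> A \<boxplus> B"
    then obtain a b where ab: "a \<in> A \<inter> OP_inf V" "b \<in> B \<inter> OP_inf V" "proj_approx V c (dsum a b)"
      unfolding class_add_def by blast
    then have "proj_approx V c (dsum b a)"
      using proj_approx_comm[of a b] proj_approx_trans by blast
    with ab show "c \<in> B \<boxplus> A" unfolding class_add_def by blast
  qed
  then show ?thesis by blast
qed

text \<open>A description of triple sums by representatives alone: an element of the inner sum may
  be replaced by the \<open>a \<oplus> b\<close> to which it is equivalent.\<close>

lemma mem_class_add_assoc:
  "d \<in> (A \<boxplus> B) \<boxplus> C \<longleftrightarrow> (\<exists>a \<in> A \<inter> OP_inf V. \<exists>b \<in> B \<inter> OP_inf V. \<exists>c \<in> C \<inter> OP_inf V.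
     proj_approx V d (dsum a (dsum b c)))"
proof
  assume "d \<in> (A \<boxplus> B) \<boxplus> C"
  then obtain x c where x: "x \<in> A \<boxplus> B" "c \<in> C \<inter> OP_inf V" "proj_approx V d (dsum x c)"
    unfolding class_add_def[of "A \<boxplus> B"] by blast
  obtain a b where ab: "a \<in> A \<inter> OP_inf V" "b \<in> B \<inter> OP_inf V" "proj_approx V x (dsum a b)"
    using x(1) unfolding class_add_def by blast
  have "proj_approx V (dsum x c) (dsum a (dsum b c))"
    using proj_approx_dsum_right[OF ab(3), of c] x(2) by (simp add: dsum_assoc)
  with x(3) have "proj_approx V d (dsum a (dsum b c))" by (rule proj_approx_trans)
  with ab x show "\<exists>a \<in> A \<inter> OP_inf V. \<exists>b \<in> B \<inter> OP_inf V. \<exists>c \<in> C \<inter> OP_inf V.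
     proj_approx V d (dsum a (dsum b c))" by blast
next
  assume "\<exists>a \<in> A \<inter> OP_inf V. \<exists>b \<in> B \<inter> OP_inf V. \<exists>c \<in> C \<inter> OP_inf V.
     proj_approx V d (dsum a (dsum b c))"
  then obtain a b c where abc: "a \<in> A \<inter> OP_inf V" "b \<in> B \<inter> OP_inf V" "c \<in> C \<inter> OP_inf V"
    "proj_approx V d (dsum (dsum a b) c)" unfolding dsum_assoc by blast
  have ab: "dsum a b \<in> OP_inf V" using abc OP_inf_dsum by blast
  then have "dsum a b \<in> A \<boxplus> B"
    unfolding class_add_def using abc proj_approx_refl by blast
  with ab abc show "d \<in> (A \<boxplus> B) \<boxplus> C" unfolding class_add_def[of "A \<boxplus> B"] by blast
qed

lemma class_add_left_commute: "B \<boxplus> (A \<boxplus> C) = A \<boxplus> (B \<boxplus> C)"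
  and class_add_assoc: "(A \<boxplus> B) \<boxplus> C = A \<boxplus> (B \<boxplus> C)"
proof -
  have swap: "(A \<boxplus> B) \<boxplus> C \<subseteq> (B \<boxplus> C) \<boxplus> A" for A B C
  proof
    fix d assume "d \<in> (A \<boxplus> B) \<boxplus> C"
    then obtain a b c where abc: "a \<in> A \<inter> OP_inf V" "b \<in> B \<inter> OP_inf V" "c \<in> C \<inter> OP_inf V"
      "proj_approx V d (dsum a (dsum b c))" unfolding mem_class_add_assoc by blast
    have "proj_approx V (dsum a (dsum b c)) (dsum b (dsum c a))"
      using proj_approx_comm[of a "dsum b c"] abc OP_inf_dsum by (simp add: dsum_assoc)
    with abc(4) have "proj_approx V d (dsum b (dsum c a))" by (rule proj_approx_trans)
    with abc show "d \<in> (B \<boxplus> C) \<boxplus> A" unfolding mem_class_add_assoc by blast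
  qed
  \<comment> \<open>Three cyclic shifts lead back to the start, so the inclusion is an equality.
    With commutativity this yields associativity.\<close>
  have rot: "(A \<boxplus> B) \<boxplus> C = (B \<boxplus> C) \<boxplus> A" for A B C
    using swap[of A B C] swap[of B C A] swap[of C A B] by blast
  show assoc: "(A \<boxplus> B) \<boxplus> C = A \<boxplus> (B \<boxplus> C)" for A B C
    using rot[of A B C] class_add_commute by simp
  show "B \<boxplus> (A \<boxplus> C) = A \<boxplus> (B \<boxplus> C)"
    unfolding assoc[symmetric] by (simp only: class_add_commute[of B A])
qed

lemmas class_add_ac = class_add_assoc class_add_commute class_add_left_commute

lemma iso_class_eq_iff:
  assumes "p \<in> OP_inf V"
  shows "iso_class p = iso_class q \<longleftrightarrow> proj_approx V p q"
proof
  assume "iso_class p = iso_class q"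
  then have "proj_approx V q p" using proj_approx_refl[OF assms] by (auto simp: iso_class_def)
  then show "proj_approx V p q" by (rule proj_approx_sym)
next
  assume "proj_approx V p q"
  then show "iso_class p = iso_class q"
    unfolding iso_class_def using proj_approx_trans proj_approx_sym by blast
qed

lemma iso_class_dsum:
  assumes "p \<in> OP_inf V" "q \<in> OP_inf V"
  shows "iso_class (dsum p q) = iso_class p \<boxplus> iso_class q"
proof (intro equalityI subsetI)
  fix c assume "c \<in> iso_class (dsum p q)"
  then have "proj_approx V c (dsum p q)" by (auto simp: iso_class_def intro: proj_approx_sym)
  then show "c \<in> iso_class p \<boxplus> iso_class q"
    unfolding class_add_def iso_class_def using assms proj_approx_refl by blast
next
  fix c assume "c \<in> iso_class p \<boxplus> iso_class q"
  then obtain a b where "proj_approx V p a" "proj_approx V q b" "proj_approx V c (dsum a b)"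
    unfolding class_add_def iso_class_def by blast
  then have "proj_approx V (dsum p q) c"
    using proj_approx_dsum proj_approx_trans proj_approx_sym by blast
  then show "c \<in> iso_class (dsum p q)" by (simp add: iso_class_def)
qed

lemma iso_class_cancel:
  assumes "iso_class p \<boxplus> iso_class t = iso_class q \<boxplus> iso_class t"
    and "p \<in> OP_inf V" "q \<in> OP_inf V" "t \<in> OP_inf V"
  shows "iso_class p = iso_class q"
  using assms proj_approx_cancel
  by (simp add: iso_class_dsum[symmetric] iso_class_eq_iff OP_inf_dsum)

text \<open>The zero class on the right accounts for the different sizes:
  \<open>p \<oplus> q\<close> is first compared with \<open>(p + q) \<oplus> 0\<close>, and then the
  zero block is shrunk to size 1.\<close>

lemma iso_class_dsum_of_perp:
  assumes n: "n \<ge> 1" and "p \<in> OP V n" "q \<in> OP V n" "perp V n p q"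
  shows "iso_class (dsum p q) = iso_class (p + q) \<boxplus> iso_class (0\<^sub>m 1 1)"
proof -
  have P: "p + q \<in> OP_inf V" "0\<^sub>m n n \<in> OP_inf V" "dsum p q \<in> OP_inf V"
    "(0\<^sub>m 1 1 :: 'v mat) \<in> OP_inf V"
    using assms OP_infI[OF n OP_add_of_perp[OF assms]] OP_infI[OF n] OP_inf_zero[of 1]
    by (auto intro: OP_inf_dsum OP_inf_zero)
  have "proj_approx V (dsum p q) (dsum (p + q) (0\<^sub>m n n))"
    using P proj_sim_add_of_perp[OF assms]
    by (intro proj_approx_sym[OF proj_approx_of_sim]) (auto intro: OP_inf_dsum)
  then have "iso_class (dsum p q) = iso_class (p + q) \<boxplus> iso_class (0\<^sub>m n n)"
    using P by (simp add: iso_class_eq_iff[symmetric] iso_class_dsum)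
  moreover have "iso_class (0\<^sub>m n n) = iso_class (0\<^sub>m 1 1)"
    using P proj_approx_of_sim[OF P(2,4) proj_sim_zero[OF n]] by (simp add: iso_class_eq_iff)
  ultimately show ?thesis by simp
qed

section \<open>The Grothendieck group\<close>

lemma K0_rel_iff:
  "((p, q), (p', q')) \<in> K0_rel V \<longleftrightarrow> p \<in> OP_inf V \<and> q \<in> OP_inf V \<and> p' \<in> OP_inf V \<and> q' \<in> OP_inf V \<and>
     iso_class p \<boxplus> iso_class q' = iso_class p' \<boxplus> iso_class q"
  by (simp add: K0_rel_def iso_class_dsum[symmetric] iso_class_eq_iff OP_inf_dsum cong: conj_cong)

lemma equiv_K0_rel: "equiv (OP_inf V \<times> OP_inf V) (K0_rel V)"
proof (rule equivI)
  show "K0_rel V \<subseteq> (OP_inf V \<times> OP_inf V) \<times> (OP_inf V \<times> OP_inf V)"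
    by (auto simp: K0_rel_def)
  show "refl_on (OP_inf V \<times> OP_inf V) (K0_rel V)"
    by (auto simp: refl_on_def K0_rel_iff)
  show "sym (K0_rel V)"
    by (auto simp: sym_def K0_rel_iff)
  show "trans (K0_rel V)"
  proof (rule transI)
    fix x y z assume xy: "(x, y) \<in> K0_rel V" and yz: "(y, z) \<in> K0_rel V"
    obtain p q p' q' p'' q'' where [simp]: "x = (p, q)" "y = (p', q')" "z = (p'', q'')"
      by (metis surj_pair)
    have P: "p \<in> OP_inf V" "q \<in> OP_inf V" "p' \<in> OP_inf V" "q' \<in> OP_inf V" "p'' \<in> OP_inf V" "q'' \<in> OP_inf V"
      and 1: "iso_class p \<boxplus> iso_class q' = iso_class p' \<boxplus> iso_class q"
      and 2: "iso_class p' \<boxplus> iso_class q'' = iso_class p'' \<boxplus> iso_class q'"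
      using xy yz by (auto simp: K0_rel_iff)
    \<comment> \<open>Adding the two given identities introduces \<open>p' \<oplus> q'\<close> on
      both sides, which is then cancelled.\<close>
    have "iso_class (dsum p q'') \<boxplus> iso_class (dsum p' q') =
      (iso_class p \<boxplus> iso_class q') \<boxplus> (iso_class p' \<boxplus> iso_class q'')"
      using P by (simp add: iso_class_dsum class_add_ac)
    also have "\<dots> = iso_class (dsum p'' q) \<boxplus> iso_class (dsum p' q')"
      unfolding 1 2 using P by (simp add: iso_class_dsum class_add_ac)
    finally have "iso_class (dsum p q'') = iso_class (dsum p'' q)"
      using P by (intro iso_class_cancel[of _ "dsum p' q'"]) (auto intro: OP_inf_dsum)
    then show "(x, z) \<in> K0_rel V" using P by (simp add: K0_rel_iff iso_class_dsum)
  qed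
qed

lemma K0_class_eq_iff:
  assumes "p \<in> OP_inf V" "q \<in> OP_inf V" "p' \<in> OP_inf V" "q' \<in> OP_inf V"
  shows "K0_class V p q = K0_class V p' q' \<longleftrightarrow>
    iso_class p \<boxplus> iso_class q' = iso_class p' \<boxplus> iso_class q"
  using eq_equiv_class_iff[OF equiv_K0_rel, of "(p, q)" "(p', q')"] assms
  by (simp add: K0_class_def K0_rel_iff)

lemma mem_K0_class:
  "(a, b) \<in> K0_class V p q \<Longrightarrow> a \<in> OP_inf V \<and> b \<in> OP_inf V \<and>
     iso_class p \<boxplus> iso_class b = iso_class a \<boxplus> iso_class q"
  by (simp add: K0_class_def K0_rel_iff)

lemma K0_class_self: "p \<in> OP_inf V \<Longrightarrow> q \<in> OP_inf V \<Longrightarrow> (p, q) \<in> K0_class V p q"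
  by (simp add: K0_class_def K0_rel_iff)

lemma K0_class_carrier: "p \<in> OP_inf V \<Longrightarrow> q \<in> OP_inf V \<Longrightarrow> K0_class V p q \<in> carrier (K0 V)"
  by (auto simp: K0_def K0_class_def intro: quotientI)

lemma K0_carrierE:
  assumes "x \<in> carrier (K0 V)"
  obtains p q where "p \<in> OP_inf V" "q \<in> OP_inf V" "x = K0_class V p q"
  using assms by (auto simp: K0_def K0_class_def elim!: quotientE)

lemma K0_mult:
  assumes P: "p \<in> OP_inf V" "q \<in> OP_inf V" "p' \<in> OP_inf V" "q' \<in> OP_inf V"
  shows "K0_class V p q \<otimes>\<^bsub>K0 V\<^esub> K0_class V p' q' = K0_class V (dsum p p') (dsum q q')"
proof -
  \<comment> \<open>All representatives give the same class, so the union that defines the product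
    is a union of equal sets over nonempty index sets.\<close>
  have const: "K0_class V (dsum a a') (dsum b b') = K0_class V (dsum p p') (dsum q q')"
    if ab: "(a, b) \<in> K0_class V p q" and ab': "(a', b') \<in> K0_class V p' q'" for a b a' b'
  proof -
    have A: "a \<in> OP_inf V" "b \<in> OP_inf V" "a' \<in> OP_inf V" "b' \<in> OP_inf V"
      and eq: "iso_class p \<boxplus> iso_class b = iso_class a \<boxplus> iso_class q"
        "iso_class p' \<boxplus> iso_class b' = iso_class a' \<boxplus> iso_class q'"
      using mem_K0_class[OF ab] mem_K0_class[OF ab'] by auto
    have "iso_class (dsum p p') \<boxplus> iso_class (dsum b b') =
      (iso_class p \<boxplus> iso_class b) \<boxplus> (iso_class p' \<boxplus> iso_class b')"
      using P A by (simp add: iso_class_dsum class_add_ac)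
    also have "\<dots> = (iso_class a \<boxplus> iso_class q) \<boxplus> (iso_class a' \<boxplus> iso_class q')"
      by (simp only: eq)
    also have "\<dots> = iso_class (dsum a a') \<boxplus> iso_class (dsum q q')"
      using P A by (simp add: iso_class_dsum class_add_ac)
    finally show ?thesis
      using P A by (subst K0_class_eq_iff) (auto intro: OP_inf_dsum)
  qed
  have "K0_class V p q \<otimes>\<^bsub>K0 V\<^esub> K0_class V p' q' =
    (\<Union>(a, b) \<in> K0_class V p q. \<Union>(a', b') \<in> K0_class V p' q'. K0_class V (dsum a a') (dsum b b'))"
    by (simp add: K0_def)
  also have "\<dots> = (\<Union>(a, b) \<in> K0_class V p q. \<Union>(a', b') \<in> K0_class V p' q'. K0_class V (dsum p p') (dsum q q'))"
    using const by (intro SUP_cong refl) (auto intro!: SUP_cong)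
  also have "\<dots> = K0_class V (dsum p p') (dsum q q')"
    using K0_class_self[OF P(1,2)] K0_class_self[OF P(3,4)] by auto
  finally show ?thesis .
qed

end

section \<open>Maps preserving absolute values\<close>

lemma map_mat_dsum: "f 0 = 0 \<Longrightarrow> map_mat f (dsum v w) = dsum (map_mat f v) (map_mat f w)"
  by (rule eq_matI) auto

lemma map_mat_adsum: "f 0 = 0 \<Longrightarrow> map_mat f (adsum v w) = adsum (map_mat f v) (map_mat f w)"
  by (rule eq_matI) auto

lemma map_mat_zero: "f 0 = 0 \<Longrightarrow> map_mat f (0\<^sub>m m n) = 0\<^sub>m m n"
  by (rule eq_matI) auto

lemma map_mat_fun_add: "map_mat (\<lambda>v. f v + g v) A = map_mat f A + map_mat g A"
  by (rule eq_matI) auto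

locale star_linear_map =
  V: abs_matrix_order_unit V + W: abs_matrix_order_unit W
  for V :: "('v::ab_group_add, 'y) matrix_space_scheme"
    and W :: "('w::ab_group_add, 'z) matrix_space_scheme"
    and \<phi> :: "'v \<Rightarrow> 'w" +
  assumes star_lin: "star_linear V W \<phi>"
begin

lemma linear: "Vector_Spaces.linear (smul V) (smul W) \<phi>"
  and map_star: "\<phi> (star V x) = star W (\<phi> x)"
  using star_lin by (auto simp: star_linear_def)

sublocale lin: Vector_Spaces.linear "smul V" "smul W" \<phi>
  by (rule linear)

lemma map_mat_star: "map_mat \<phi> (mstar V v) = mstar W (map_mat \<phi> v)"
  by (rule eq_matI) (auto simp: map_star)

lemma map_mat_rsmul: "map_mat \<phi> (rsmul V k v) = rsmul W k (map_mat \<phi> v)"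
  by (rule eq_matI) (auto simp: lin.scale)

lemma map_mat_add:
  "v \<in> carrier_mat m n \<Longrightarrow> w \<in> carrier_mat m n \<Longrightarrow> map_mat \<phi> (v + w) = map_mat \<phi> v + map_mat \<phi> w"
  by (rule eq_matI) (auto simp: lin.add)

end

locale abs_preserving_map = star_linear_map V W \<phi>
  for V :: "('v::ab_group_add, 'y) matrix_space_scheme"
    and W :: "('w::ab_group_add, 'z) matrix_space_scheme"
    and \<phi> :: "'v \<Rightarrow> 'w" +
  assumes abs_pres: "completely_abs_preserving V W \<phi>"
    and projs: "maps_projections V W \<phi>"
begin

lemma map_mabs_square:
  "n \<ge> 1 \<Longrightarrow> v \<in> carrier_mat n n \<Longrightarrow> mabs W (map_mat \<phi> v) = map_mat \<phi> (mabs V v)"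
  using abs_pres by (simp add: completely_abs_preserving_def)

lemma map_cone:
  assumes "n \<ge> 1" "v \<in> mcone V n"
  shows "map_mat \<phi> v \<in> mcone W n"
proof -
  have car: "v \<in> carrier_mat n n" using V.cone_carrier[OF assms] .
  have "mabs W (map_mat \<phi> v) \<in> mcone W n"
    using car by (intro W.mabs_cone[OF assms(1,1)]) auto
  then show ?thesis using map_mabs_square[OF assms(1) car] V.mabs_of_cone[OF assms] by simp
qed

text \<open>The hypothesis on \<open>\<phi>\<close> covers square matrices only. Applied to the
  dilation of \<open>v\<close>, of size \<open>m + n\<close>, it gives the rectangular case in the
  lower diagonal block.\<close>

lemma map_mabs:
  assumes mn: "m \<ge> 1" "n \<ge> 1" and v: "v \<in> carrier_mat m n"
  shows "mabs W (map_mat \<phi> v) = map_mat \<phi> (mabs V v)"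
proof -
  have vs: "mstar V v \<in> carrier_mat n m" using v by simp
  have w: "map_mat \<phi> v \<in> carrier_mat m n" and ws: "mstar W (map_mat \<phi> v) \<in> carrier_mat n m"
    using v by auto
  note car = V.mabs_carrier[OF mn v] V.mabs_carrier[OF mn(2,1) vs]
    W.mabs_carrier[OF mn w] W.mabs_carrier[OF mn(2,1) ws]
  have "dsum (mabs W (mstar W (map_mat \<phi> v))) (mabs W (map_mat \<phi> v)) =
    mabs W (map_mat \<phi> (adsum v (mstar V v)))"
    using W.mabs_adsum_star[OF mn w] by (simp add: map_mat_adsum map_mat_star)
  also have "\<dots> = map_mat \<phi> (mabs V (adsum v (mstar V v)))"
    using mn v by (intro map_mabs_square[of "m + n"]) auto
  also have "\<dots> = dsum (map_mat \<phi> (mabs V (mstar V v))) (map_mat \<phi> (mabs V v))"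
    using V.mabs_adsum_star[OF mn v] by (simp add: map_mat_dsum)
  finally show ?thesis
    using dsum_eq_iff[OF car(4) map_carrier_mat[THEN iffD2, OF car(2)] car(3) map_carrier_mat[THEN iffD2, OF car(1)]]
    by simp
qed

lemma map_OP_inf: "p \<in> OP_inf V \<Longrightarrow> map_mat \<phi> p \<in> OP_inf W"
  using projs by (simp add: maps_projections_def)

lemma map_OP:
  assumes "n \<ge> 1" "p \<in> OP V n"
  shows "map_mat \<phi> p \<in> OP W n"
  using W.OP_inf_size[OF map_OP_inf[OF V.OP_infI[OF assms]], of n] V.OP_carrier[OF assms] by simp

lemma map_mnorm_le_one:
  assumes n: "n \<ge> 1" and v: "v \<in> carrier_mat n n" "mnorm V n v \<le> 1"
  shows "mnorm W n (map_mat \<phi> v) \<le> 1"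
proof (rule W.mnorm_leI[OF n])
  have nn: "n + n \<ge> 1" using n by simp
  let ?E = "munit V (n + n)" and ?F = "munit W (n + n)"
  show "map_mat \<phi> v \<in> carrier_mat n n" using v by simp
  fix k :: real assume k: "k > 1"
  have "rsmul V k ?E + adsum v (mstar V v) \<in> mcone V (n + n)"
    using V.mnorm_less_bound[OF n v(1), of k] v(2) k by simp
  then have "map_mat \<phi> (rsmul V k ?E + adsum v (mstar V v)) \<in> mcone W (n + n)"
    by (rule map_cone[OF nn])
  also have "map_mat \<phi> (rsmul V k ?E + adsum v (mstar V v)) =
    rsmul W k (map_mat \<phi> ?E) + adsum (map_mat \<phi> v) (mstar W (map_mat \<phi> v))" (is "_ = ?M")
    using v by (simp add: map_mat_add[of _ "n + n" "n + n"] map_mat_rsmul map_mat_adsum map_mat_star)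
  finally have 1: "?M \<in> mcone W (n + n)" .
  have 2: "rsmul W k (?F - map_mat \<phi> ?E) \<in> mcone W (n + n)"
    using k by (intro W.cone_rsmul[OF nn] W.OP_le_unit[OF nn] map_OP[OF nn] V.OP_munit[OF nn]) auto
  \<comment> \<open>\<open>\<phi>\<close> sends the unit to a projection, which may be smaller than
    the unit of \<open>W\<close>; \<open>k\<close> times the positive difference makes up for
    this.\<close>
  have "rsmul W k ?F + adsum (map_mat \<phi> v) (mstar W (map_mat \<phi> v)) =
    rsmul W k (?F - map_mat \<phi> ?E) + ?M"
    using v by (intro eq_matI) (auto simp: W.vs.scale_right_diff_distrib)
  then show "rsmul W k ?F + adsum (map_mat \<phi> v) (mstar W (map_mat \<phi> v)) \<in> mcone W (n + n)"
    using W.cone_add[OF nn 2 1] by simp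
qed simp

lemma amp_norm_le_one: "n \<ge> 1 \<Longrightarrow> amp_norm V W \<phi> n \<le> 1"
  unfolding amp_norm_def using map_mnorm_le_one by (auto intro!: SUP_least)

lemma cb_norm_le_one: "cb_norm V W \<phi> \<le> 1"
  unfolding cb_norm_def using amp_norm_le_one by (auto intro!: SUP_least)

lemma contractive: "completely_contractive V W \<phi>"
  using cb_norm_le_one by (simp add: completely_contractive_def)

lemma mnorm_le_cb_norm:
  assumes "n \<ge> 1" "v \<in> carrier_mat n n" "mnorm V n v \<le> 1"
  shows "ereal (mnorm W n (map_mat \<phi> v)) \<le> cb_norm V W \<phi>"
proof -
  have "ereal (mnorm W n (map_mat \<phi> v)) \<le> amp_norm V W \<phi> n"
    unfolding amp_norm_def using assms by (intro SUP_upper) auto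
  also have "\<dots> \<le> cb_norm V W \<phi>"
    unfolding cb_norm_def using assms by (intro SUP_upper) auto
  finally show ?thesis .
qed

lemma munit_mnorm_le_one: "mnorm V 1 (munit V 1) \<le> 1"
  using V.cone_mnorm_le_one_iff[of 1 "munit V 1"] V.OP_le_unit[OF _ V.OP_munit, of 1] V.munit_1_cone
  by simp

lemma cb_norm_nonneg: "0 \<le> cb_norm V W \<phi>"
proof -
  have "0 \<le> ereal (mnorm W 1 (map_mat \<phi> (munit V 1)))"
    using W.mnorm_nonneg[of 1 "map_mat \<phi> (munit V 1)"] by simp
  also have "\<dots> \<le> cb_norm V W \<phi>"
    by (rule mnorm_le_cb_norm) (use munit_mnorm_le_one in auto)
  finally show ?thesis .
qed

text \<open>The unit has norm at most 1, and its image is a nonzero projection, whose norm is at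
  least 1.\<close>

lemma cb_norm_eq_one:
  assumes "\<phi> (ounit V) \<noteq> 0"
  shows "cb_norm V W \<phi> = 1"
proof (rule antisym[OF cb_norm_le_one])
  have "map_mat \<phi> (munit V 1) \<in> OP W 1"
    by (intro map_OP V.OP_munit) auto
  moreover have "map_mat \<phi> (munit V 1) \<noteq> 0\<^sub>m 1 1"
  proof
    assume "map_mat \<phi> (munit V 1) = 0\<^sub>m 1 1"
    then have "map_mat \<phi> (munit V 1) $$ (0, 0) = 0\<^sub>m 1 1 $$ (0, 0)" by (rule arg_cong)
    then show False using assms by simp
  qed
  ultimately have "1 \<le> ereal (mnorm W 1 (map_mat \<phi> (munit V 1)))"
    using W.OP_mnorm_ge_one[of 1] by simp
  also have "\<dots> \<le> cb_norm V W \<phi>"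
    by (rule mnorm_le_cb_norm) (use munit_mnorm_le_one in auto)
  finally show "1 \<le> cb_norm V W \<phi>" .
qed

text \<open>If \<open>\<phi>\<close> kills the order unit, it kills everything between \<open>0\<close> and a multiple of the unit, hence
  all absolute values.\<close>

lemma eq_zero_if_unit:
  assumes "\<phi> (ounit V) = 0"
  shows "\<phi> x = 0"
proof -
  have le: "(1 :: nat) \<ge> 1" by simp
  have abs0: "map_mat \<phi> (mabs V v) = 0\<^sub>m 1 1" if v: "v \<in> carrier_mat 1 1" for v
  proof -
    note c = V.mabs_cone[OF le le v]
    note car = V.cone_carrier[OF le c]
    obtain k where k: "k > 0" "rsmul V k (munit V 1) - mabs V v \<in> mcone V 1"
      using V.cone_le_unit[OF le c] by blast
    have "map_mat \<phi> (rsmul V k (munit V 1) - mabs V v) = - map_mat \<phi> (mabs V v)"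
      using car assms by (intro eq_matI) (auto simp: lin.diff lin.scale)
    then have "- map_mat \<phi> (mabs V v) \<in> mcone W 1"
      using map_cone[OF le k(2)] by simp
    then show ?thesis using W.cone_antisym_zero[OF le map_cone[OF le c]] by simp
  qed
  \<comment> \<open>An arbitrary \<open>x\<close> need not be self-adjoint, so the absolute values
    of both \<open>\<phi>(x)\<close> and its adjoint are shown to vanish.\<close>
  let ?X = "mat 1 1 (\<lambda>_. x)"
  have X: "?X \<in> carrier_mat 1 1" and Xs: "mstar V ?X \<in> carrier_mat 1 1" by auto
  have "mabs W (map_mat \<phi> ?X) = 0\<^sub>m 1 1" "mabs W (mstar W (map_mat \<phi> ?X)) = 0\<^sub>m 1 1"
    using map_mabs[OF le le X] map_mabs[OF le le Xs] abs0[OF X] abs0[OF Xs]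
    by (simp_all only: map_mat_star)
  then have "map_mat \<phi> ?X = 0\<^sub>m 1 1"
    using W.mabs_eq_zero[OF le le map_carrier_mat[THEN iffD2, OF X]] by blast
  then have "map_mat \<phi> ?X $$ (0, 0) = 0\<^sub>m 1 1 $$ (0, 0)" by (rule arg_cong)
  then show ?thesis by simp
qed

lemma cb_norm_eq_zero:
  assumes "\<phi> (ounit V) = 0"
  shows "cb_norm V W \<phi> = 0"
proof (rule antisym[OF _ cb_norm_nonneg])
  have "mnorm W n (map_mat \<phi> v) \<le> 0" if n: "n \<ge> 1" and v: "v \<in> carrier_mat n n" for n v
  proof (rule W.mnorm_leI[OF n])
    have nn: "n + n \<ge> 1" using n by simp
    fix k :: real assume k: "0 < k"
    have "rsmul W k (munit W (n + n)) + adsum (map_mat \<phi> v) (mstar W (map_mat \<phi> v)) = rsmul W k (munit W (n + n))"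
      using v by (intro eq_matI) (auto simp: eq_zero_if_unit[OF assms])
    then show "rsmul W k (munit W (n + n)) + adsum (map_mat \<phi> v) (mstar W (map_mat \<phi> v)) \<in> mcone W (n + n)"
      using k W.cone_rsmul[OF nn _ W.munit_cone[OF nn]] by simp
  qed (use v in auto)
  then show "cb_norm V W \<phi> \<le> 0"
    unfolding cb_norm_def amp_norm_def by (auto intro!: SUP_least)
qed

lemma map_proj_sim:
  assumes "proj_sim V p q"
  shows "proj_sim W (map_mat \<phi> p) (map_mat \<phi> q)"
proof -
  obtain m n v where v: "m \<ge> 1" "n \<ge> 1" "v \<in> carrier_mat m n"
    "mabs V (mstar V v) = p" "mabs V v = q" "p \<in> OP V m" "q \<in> OP V n"
    using V.proj_simE[OF assms] .
  then show ?thesis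
    using map_mabs[of n m "mstar V v"] map_mabs[of m n v]
    by (intro W.proj_simI[of m n "map_mat \<phi> v"]) (auto simp: map_mat_star intro: map_OP)
qed

lemma map_proj_approx:
  assumes "proj_approx V p q"
  shows "proj_approx W (map_mat \<phi> p) (map_mat \<phi> q)"
proof -
  obtain r where r: "p \<in> OP_inf V" "q \<in> OP_inf V" "r \<in> OP_inf V" "proj_sim V (dsum p r) (dsum q r)"
    using assms by (auto simp: proj_approx_def)
  have "proj_sim W (dsum (map_mat \<phi> p) (map_mat \<phi> r)) (dsum (map_mat \<phi> q) (map_mat \<phi> r))"
    using map_proj_sim[OF r(4)] by (simp add: map_mat_dsum)
  then show ?thesis
    unfolding proj_approx_def using r map_OP_inf by blast
qed

end

section \<open>The induced homomorphism of \<open>K0\<close> groups\<close>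

locale abs_preserving_map_T = abs_preserving_map V W \<phi> +
    V: abs_matrix_order_unit_T V + W: abs_matrix_order_unit_T W
  for V :: "('v::ab_group_add, 'y) matrix_space_scheme"
    and W :: "('w::ab_group_add, 'z) matrix_space_scheme"
    and \<phi> :: "'v \<Rightarrow> 'w"
begin

lemma map_K0_class_cong:
  assumes P: "p \<in> OP_inf V" "q \<in> OP_inf V" "p' \<in> OP_inf V" "q' \<in> OP_inf V"
    and "K0_class V p q = K0_class V p' q'"
  shows "K0_class W (map_mat \<phi> p) (map_mat \<phi> q) = K0_class W (map_mat \<phi> p') (map_mat \<phi> q')"
proof -
  have "V.iso_class (dsum p q') = V.iso_class (dsum p' q)"
    using assms by (simp add: V.K0_class_eq_iff V.iso_class_dsum)
  then have "proj_approx V (dsum p q') (dsum p' q)"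
    using P by (simp add: V.iso_class_eq_iff V.OP_inf_dsum)
  then have "proj_approx W (dsum (map_mat \<phi> p) (map_mat \<phi> q')) (dsum (map_mat \<phi> p') (map_mat \<phi> q))"
    using map_proj_approx[of "dsum p q'" "dsum p' q"] by (simp add: map_mat_dsum)
  then show ?thesis
    using P map_OP_inf
    by (simp add: W.K0_class_eq_iff W.iso_class_dsum[symmetric] W.iso_class_eq_iff W.OP_inf_dsum)
qed

text \<open>The arbitrary choice of representatives is harmless by \<open>map_K0_class_cong\<close>.
  Restriction to the carrier makes the function extensional, as \<open>K0_map\<close>
  demands.\<close>

definition K0_induced :: "('v mat \<times> 'v mat) set \<Rightarrow> ('w mat \<times> 'w mat) set" where
  "K0_induced = (\<lambda>x \<in> carrier (K0 V). let (p, q) = (SOME (p, q). p \<in> OP_inf V \<and> q \<in> OP_inf V \<and> x = K0_class V p q)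
     in K0_class W (map_mat \<phi> p) (map_mat \<phi> q))"

lemma K0_induced_class:
  assumes "p \<in> OP_inf V" "q \<in> OP_inf V"
  shows "K0_induced (K0_class V p q) = K0_class W (map_mat \<phi> p) (map_mat \<phi> q)"
proof -
  let ?P = "\<lambda>(p', q'). p' \<in> OP_inf V \<and> q' \<in> OP_inf V \<and> K0_class V p q = K0_class V p' q'"
  obtain p' q' where eq: "Eps ?P = (p', q')" by (cases "Eps ?P")
  have "?P (Eps ?P)" by (rule someI[of _ "(p, q)"]) (use assms in simp)
  then have pq': "p' \<in> OP_inf V" "q' \<in> OP_inf V" "K0_class V p q = K0_class V p' q'"
    unfolding eq by auto
  have "K0_induced (K0_class V p q) = K0_class W (map_mat \<phi> p') (map_mat \<phi> q')"
    using V.K0_class_carrier[OF assms] by (simp add: K0_induced_def eq)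
  also have "\<dots> = K0_class W (map_mat \<phi> p) (map_mat \<phi> q)"
    using map_K0_class_cong[OF assms pq'] by (rule sym)
  finally show ?thesis .
qed

lemma K0_induced_hom: "K0_induced \<in> hom (K0 V) (K0 W)"
proof (rule homI)
  fix x assume "x \<in> carrier (K0 V)"
  then show "K0_induced x \<in> carrier (K0 W)"
    by (elim V.K0_carrierE) (simp add: K0_induced_class W.K0_class_carrier map_OP_inf)
next
  fix x y assume "x \<in> carrier (K0 V)" "y \<in> carrier (K0 V)"
  then show "K0_induced (x \<otimes>\<^bsub>K0 V\<^esub> y) = K0_induced x \<otimes>\<^bsub>K0 W\<^esub> K0_induced y"
    by (elim V.K0_carrierE)
      (simp add: V.K0_mult W.K0_mult K0_induced_class V.OP_inf_dsum map_OP_inf map_mat_dsum)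
qed

text \<open>Uniqueness: \<open>[(p, q)] + [(q, 0)] = [(p, 0)]\<close>, so the values on the classes \<open>[(p, 0)]\<close>
  determine all others by cancellation.\<close>

lemma K0_map_eq_K0_induced: "K0_map V W \<phi> = K0_induced"
  unfolding K0_map_def
proof (rule the_equality)
  let ?z = "0\<^sub>m 1 1" and ?z' = "0\<^sub>m 1 1"
  have z: "?z \<in> OP_inf V" "?z' \<in> OP_inf W" by (auto intro: V.OP_inf_zero W.OP_inf_zero)
  show "K0_induced \<in> hom (K0 V) (K0 W) \<and> K0_induced \<in> extensional (carrier (K0 V)) \<and>
    (\<forall>p \<in> OP_inf V. K0_induced (K0_class V p ?z) = K0_class W (map_mat \<phi> p) ?z')"
    using K0_induced_hom z by (simp add: K0_induced_class map_mat_zero) (simp add: K0_induced_def)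
  fix f assume f: "f \<in> hom (K0 V) (K0 W) \<and> f \<in> extensional (carrier (K0 V)) \<and>
    (\<forall>p \<in> OP_inf V. f (K0_class V p ?z) = K0_class W (map_mat \<phi> p) ?z')"
  show "f = K0_induced"
  proof (rule extensionalityI[of _ "carrier (K0 V)"])
    fix x assume x: "x \<in> carrier (K0 V)"
    then obtain p q where pq: "p \<in> OP_inf V" "q \<in> OP_inf V" "x = K0_class V p q"
      using V.K0_carrierE by blast
    \<comment> \<open>The unknown value is written as the class of some pair \<open>(a, b)\<close>,
      which the homomorphism property then determines.\<close>
    have "f x \<in> carrier (K0 W)" using f x by (auto simp: hom_def)
    then obtain a b where ab: "a \<in> OP_inf W" "b \<in> OP_inf W" "f x = K0_class W a b"
      using W.K0_carrierE by blast
    have "x \<otimes>\<^bsub>K0 V\<^esub> K0_class V q ?z = K0_class V (dsum p q) (dsum q ?z)"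
      using pq z by (simp add: V.K0_mult)
    also have "\<dots> = K0_class V p ?z"
      using pq z by (simp add: V.K0_class_eq_iff V.OP_inf_dsum V.iso_class_dsum V.class_add_ac)
    finally have eq: "x \<otimes>\<^bsub>K0 V\<^esub> K0_class V q ?z = K0_class V p ?z" .
    have "f (x \<otimes>\<^bsub>K0 V\<^esub> K0_class V q ?z) = f x \<otimes>\<^bsub>K0 W\<^esub> f (K0_class V q ?z)"
      using f x V.K0_class_carrier[OF pq(2) z(1)] by (simp add: hom_mult)
    then have "f (K0_class V p ?z) = K0_class W a b \<otimes>\<^bsub>K0 W\<^esub> f (K0_class V q ?z)"
      by (simp only: eq ab(3))
    then have "K0_class W (map_mat \<phi> p) ?z' = K0_class W a b \<otimes>\<^bsub>K0 W\<^esub> K0_class W (map_mat \<phi> q) ?z'"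
      using f pq by (simp only:)
    then have "K0_class W (map_mat \<phi> p) ?z' = K0_class W (dsum a (map_mat \<phi> q)) (dsum b ?z')"
      by (simp only: W.K0_mult[OF ab(1,2) map_OP_inf[OF pq(2)] z(2)])
    then have "W.class_add (W.iso_class (map_mat \<phi> p)) (W.iso_class (dsum b ?z')) =
      W.class_add (W.iso_class (dsum a (map_mat \<phi> q))) (W.iso_class ?z')"
      using pq ab z map_OP_inf by (simp only: W.K0_class_eq_iff W.OP_inf_dsum)
    then have "W.class_add (W.iso_class (dsum (map_mat \<phi> p) b)) (W.iso_class ?z') =
      W.class_add (W.iso_class (dsum a (map_mat \<phi> q))) (W.iso_class ?z')"
      using pq ab z map_OP_inf by (simp add: W.iso_class_dsum W.class_add_assoc)
    \<comment> \<open>Cancelling the zero class leaves the relation that identifies the class of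
      \<open>(a, b)\<close> with that of the images of \<open>p\<close> and
      \<open>q\<close>.\<close>
    then have "W.iso_class (dsum (map_mat \<phi> p) b) = W.iso_class (dsum a (map_mat \<phi> q))"
      by (rule W.iso_class_cancel) (use pq ab z map_OP_inf in \<open>auto intro: W.OP_inf_dsum\<close>)
    then show "f x = K0_induced x"
      using pq ab map_OP_inf
      by (simp add: K0_induced_class W.K0_class_eq_iff W.iso_class_dsum)
  qed (use f in \<open>auto simp: K0_induced_def\<close>)
qed

lemma K0_map_class:
  "p \<in> OP_inf V \<Longrightarrow> q \<in> OP_inf V \<Longrightarrow>
     K0_map V W \<phi> (K0_class V p q) = K0_class W (map_mat \<phi> p) (map_mat \<phi> q)"
  by (simp add: K0_map_eq_K0_induced K0_induced_class)

lemma K0_map_extensional: "K0_map V W \<phi> \<in> extensional (carrier (K0 V))"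
  by (simp add: K0_map_eq_K0_induced K0_induced_def)

end

section \<open>Sums of completely orthogonal maps\<close>

locale orthogonal_abs_preserving_maps =
  \<phi>: abs_preserving_map V W \<phi> + \<psi>: abs_preserving_map V W \<psi>
  for V :: "('v::ab_group_add, 'y) matrix_space_scheme"
    and W :: "('w::ab_group_add, 'z) matrix_space_scheme"
    and \<phi> \<psi> :: "'v \<Rightarrow> 'w" +
  assumes orth: "completely_orthogonal V W \<phi> \<psi>"
begin

lemma perp_images:
  "n \<ge> 1 \<Longrightarrow> u \<in> mcone V n \<Longrightarrow> v \<in> mcone V n \<Longrightarrow> perp W n (map_mat \<phi> u) (map_mat \<psi> v)"
  using orth by (simp add: completely_orthogonal_def)

lemma star_linear_sum: "star_linear V W (\<lambda>v. \<phi> v + \<psi> v)"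
  unfolding star_linear_def Vector_Spaces.linear_iff
  using \<phi>.V.vs.vector_space_axioms \<phi>.W.vs.vector_space_axioms
  by (simp add: \<phi>.lin.add \<psi>.lin.add \<phi>.lin.scale \<psi>.lin.scale \<phi>.map_star \<psi>.map_star
      \<phi>.W.vs.scale_right_distrib add_ac)

text \<open>The absolute values of the images of \<open>v\<close> are the images of
  \<open>|v|\<close>, hence orthogonal; the same holds for \<open>v*\<close>. These are the two
  conditions for additivity of the absolute value.\<close>

lemma abs_preserving_sum: "completely_abs_preserving V W (\<lambda>v. \<phi> v + \<psi> v)"
  unfolding completely_abs_preserving_def
proof (intro conjI star_linear_sum allI impI ballI)
  fix n and v :: "'v mat" assume n: "1 \<le> n" and v: "v \<in> carrier_mat n n"
  have vs: "mstar V v \<in> carrier_mat n n" using v by simp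
  have car: "map_mat \<phi> v \<in> carrier_mat n n" "map_mat \<psi> v \<in> carrier_mat n n" using v by auto
  have "mabs W (map_mat \<phi> v + map_mat \<psi> v) = mabs W (map_mat \<phi> v) + mabs W (map_mat \<psi> v)"
  proof (rule \<phi>.W.mabs_add_of_perp[OF n n car])
    show "perp W n (mabs W (map_mat \<phi> v)) (mabs W (map_mat \<psi> v))"
      unfolding \<phi>.map_mabs[OF n n v] \<psi>.map_mabs[OF n n v]
      by (intro perp_images[OF n] \<phi>.V.mabs_cone[OF n n v])
    show "perp W n (mabs W (mstar W (map_mat \<phi> v))) (mabs W (mstar W (map_mat \<psi> v)))"
      unfolding \<phi>.map_mat_star[symmetric] \<psi>.map_mat_star[symmetric]
        \<phi>.map_mabs[OF n n vs] \<psi>.map_mabs[OF n n vs]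
      by (intro perp_images[OF n] \<phi>.V.mabs_cone[OF n n vs])
  qed
  then show "mabs W (map_mat (\<lambda>v. \<phi> v + \<psi> v) v) = map_mat (\<lambda>v. \<phi> v + \<psi> v) (mabs V v)"
    by (simp only: map_mat_fun_add \<phi>.map_mabs[OF n n v] \<psi>.map_mabs[OF n n v])
qed

lemma maps_projections_sum: "maps_projections V W (\<lambda>v. \<phi> v + \<psi> v)"
  unfolding maps_projections_def
proof
  fix p assume "p \<in> OP_inf V"
  then obtain n where n: "n \<ge> 1" and p: "p \<in> OP V n" by (rule \<phi>.V.OP_infE)
  have pc: "p \<in> mcone V n" by (rule \<phi>.V.OP_cone[OF n p])
  show "map_mat (\<lambda>v. \<phi> v + \<psi> v) p \<in> OP_inf W"
    unfolding map_mat_fun_add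
    by (rule \<phi>.W.OP_infI[OF n \<phi>.W.OP_add_of_perp[OF n \<phi>.map_OP[OF n p] \<psi>.map_OP[OF n p]
          perp_images[OF n pc pc]]])
qed

sublocale sum: abs_preserving_map V W "\<lambda>v. \<phi> v + \<psi> v"
  by unfold_locales (rule star_linear_sum abs_preserving_sum maps_projections_sum)+

text \<open>The norms involved take only the values 0 and 1, according to whether the unit is mapped
  to zero, and a map that kills the unit is zero.\<close>

lemma cb_norm_sum: "cb_norm V W (\<lambda>v. \<phi> v + \<psi> v) = max (cb_norm V W \<phi>) (cb_norm V W \<psi>)"
proof -
  consider "\<phi> (ounit V) = 0" | "\<psi> (ounit V) = 0" | "\<phi> (ounit V) \<noteq> 0" "\<psi> (ounit V) \<noteq> 0"
    by blast
  then show ?thesis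
  proof cases
    case 1
    then have "(\<lambda>v. \<phi> v + \<psi> v) = \<psi>" by (simp add: \<phi>.eq_zero_if_unit)
    then show ?thesis using \<phi>.cb_norm_eq_zero[OF 1] \<psi>.cb_norm_nonneg by (simp add: max_def)
  next
    case 2
    then have "(\<lambda>v. \<phi> v + \<psi> v) = \<phi>" by (simp add: \<psi>.eq_zero_if_unit)
    then show ?thesis using \<psi>.cb_norm_eq_zero[OF 2] \<phi>.cb_norm_nonneg by (simp add: max_def)
  next
    case 3
    \<comment> \<open>Both images of the unit are positive, so they cannot cancel each other unless
      they vanish.\<close>
    have "\<phi> (ounit V) + \<psi> (ounit V) \<noteq> 0"
    proof
      assume "\<phi> (ounit V) + \<psi> (ounit V) = 0"
      then have "map_mat \<psi> (munit V 1) = - map_mat \<phi> (munit V 1)"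
        by (intro eq_matI) (auto simp: eq_neg_iff_add_eq_0 add.commute)
      then have "map_mat \<phi> (munit V 1) = 0\<^sub>m 1 1"
        using \<phi>.map_cone[OF _ \<phi>.V.munit_1_cone] \<psi>.map_cone[OF _ \<phi>.V.munit_1_cone]
        by (intro \<phi>.W.cone_antisym_zero) auto
      then have "map_mat \<phi> (munit V 1) $$ (0, 0) = 0\<^sub>m 1 1 $$ (0, 0)" by (rule arg_cong)
      then show False using 3 by simp
    qed
    then show ?thesis
      using 3 by (simp add: sum.cb_norm_eq_one \<phi>.cb_norm_eq_one \<psi>.cb_norm_eq_one)
  qed
qed

lemma K0_map_sum:
  assumes "condition_T V" "condition_T W"
  shows "K0_map V W (\<lambda>v. \<phi> v + \<psi> v) =
    (\<lambda>x \<in> carrier (K0 V). K0_map V W \<phi> x \<otimes>\<^bsub>K0 W\<^esub> K0_map V W \<psi> x)"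
proof -
  interpret V: abs_matrix_order_unit_T V by unfold_locales (rule assms)
  interpret W: abs_matrix_order_unit_T W by unfold_locales (rule assms)
  interpret \<phi>: abs_preserving_map_T V W \<phi> by unfold_locales
  interpret \<psi>: abs_preserving_map_T V W \<psi> by unfold_locales
  interpret s: abs_preserving_map_T V W "\<lambda>v. \<phi> v + \<psi> v" by unfold_locales
  have iso: "W.iso_class (dsum (map_mat \<phi> p) (map_mat \<psi> p)) =
      W.class_add (W.iso_class (map_mat (\<lambda>v. \<phi> v + \<psi> v) p)) (W.iso_class (0\<^sub>m 1 1))"
    if p: "p \<in> OP_inf V" for p
  proof -
    obtain n where n: "n \<ge> 1" "p \<in> OP V n" using \<phi>.V.OP_infE[OF p] .
    then show ?thesis
      unfolding map_mat_fun_add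
      by (intro W.iso_class_dsum_of_perp[of n] \<phi>.map_OP \<psi>.map_OP perp_images \<phi>.V.OP_cone)
  qed
  show ?thesis
  proof (rule extensionalityI[OF s.K0_map_extensional])
    fix x assume x: "x \<in> carrier (K0 V)"
    then obtain p q where pq: "p \<in> OP_inf V" "q \<in> OP_inf V" and x_eq: "x = K0_class V p q"
      by (rule V.K0_carrierE)
    note im = \<phi>.map_OP_inf[OF pq(1)] \<phi>.map_OP_inf[OF pq(2)] \<psi>.map_OP_inf[OF pq(1)]
      \<psi>.map_OP_inf[OF pq(2)] sum.map_OP_inf[OF pq(1)] sum.map_OP_inf[OF pq(2)]
    have "K0_map V W (\<lambda>v. \<phi> v + \<psi> v) x =
      K0_class W (map_mat (\<lambda>v. \<phi> v + \<psi> v) p) (map_mat (\<lambda>v. \<phi> v + \<psi> v) q)"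
      unfolding x_eq using pq by (rule s.K0_map_class)
    \<comment> \<open>Expanding the direct sums by \<open>iso\<close> for \<open>p\<close> and for
      \<open>q\<close> puts the class of zero once on each side of the defining identity, so the two
      sides agree up to rearrangement.\<close>
    also have "\<dots> = K0_class W (dsum (map_mat \<phi> p) (map_mat \<psi> p)) (dsum (map_mat \<phi> q) (map_mat \<psi> q))"
      by (subst W.K0_class_eq_iff[OF im(5,6) \<phi>.W.OP_inf_dsum[OF im(1,3)] \<phi>.W.OP_inf_dsum[OF im(2,4)]])
        (simp only: iso[OF pq(1)] iso[OF pq(2)] W.class_add_ac)
    also have "\<dots> = K0_map V W \<phi> x \<otimes>\<^bsub>K0 W\<^esub> K0_map V W \<psi> x"
      unfolding x_eq \<phi>.K0_map_class[OF pq] \<psi>.K0_map_class[OF pq] by (rule W.K0_mult[OF im(1-4), symmetric])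
    finally show "K0_map V W (\<lambda>v. \<phi> v + \<psi> v) x =
      (\<lambda>x \<in> carrier (K0 V). K0_map V W \<phi> x \<otimes>\<^bsub>K0 W\<^esub> K0_map V W \<psi> x) x"
      using x by simp
  qed simp
qed

end

theorem theorem5p10:
  fixes V :: "'v::ab_group_add matrix_space"
    and W :: "'w::ab_group_add matrix_space"
    and \<phi> \<psi> :: "'v \<Rightarrow> 'w"
  assumes "abs_matrix_order_unit_space V"
    and "abs_matrix_order_unit_space W"
    and "completely_abs_preserving V W \<phi>"
    and "completely_abs_preserving V W \<psi>"
    and "completely_orthogonal V W \<phi> \<psi>"
    and "maps_projections V W \<phi>"
    and "maps_projections V W \<psi>"
  shows "maps_projections V W (\<lambda>v. \<phi> v + \<psi> v)
    \<and> (completely_contractive V W \<phi>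
       \<and> completely_contractive V W \<psi>
       \<and> completely_contractive V W (\<lambda>v. \<phi> v + \<psi> v)
       \<and> cb_norm V W (\<lambda>v. \<phi> v + \<psi> v) = max (cb_norm V W \<phi>) (cb_norm V W \<psi>))
    \<and> (condition_T V \<and> condition_T W \<longrightarrow>
         K0_map V W (\<lambda>v. \<phi> v + \<psi> v) =
           (\<lambda>x \<in> carrier (K0 V). K0_map V W \<phi> x \<otimes>\<^bsub>K0 W\<^esub> K0_map V W \<psi> x))"
proof -
  interpret orthogonal_abs_preserving_maps V W \<phi> \<psi>
    using assms by unfold_locales (auto simp: completely_abs_preserving_def)
  show ?thesis
    using maps_projections_sum \<phi>.contractive \<psi>.contractive sum.contractive cb_norm_sum K0_map_sum
    by blast
qed

end
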